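(* Let $0<p<1$ and let $P_n$ be the number of distinct source-to-sink paths in a random series-parallel network of size $n$ generated by the Bernoulli model with parameter $p$. Then \[ \mathbb{E}(P_n)=\begin{cases}\displaystyle\sum_{j=0}^{n-1}(-1)^{n+j-1}\binom{(2p-1)j-1}{n-1}\sum_{k=0}^{n-1}\binom{k}{j}\Big(\frac{p}{2p-1}\Big)^k, & p\neq\frac12,\\[2ex] \displaystyle\sum_{k=0}^{n-1}\frac{(-1)^k}{2^k}B_k\big(-H^{(1)}_{n-1},-H^{(2)}_{n-1},-2H^{(3)}_{n-1},\dots,-(k-1)!H^{(k)}_{n-1}\big), & p=\frac12 .\end{cases} \] Moreover, as $n\to\infty$, \[ \mathbb{E}(P_n)=\frac{1}{1-p}\,\alpha_p^{\,n}+R_p(n), \] where $\alpha_p=\Big(1-\big(\tfrac{p}{1-p}\big)^{\frac{1}{1-2p}}\Big)^{-1}$ for $p\ne\frac12$ and $\alpha_{1/2}=\frac{1}{1-e^{-2}}$, and \[ R_p(n)=\begin{cases}-\frac{1-2p}{p\,\Gamma(2p)}n^{2p-1}+\mathcal{O}(n^{2(2p-1)}), & 0<p<\frac12,\\ -\frac{2}{\log n}+\mathcal{O}\big(\frac{1}{\log^2 n}\big), & p=\frac12,\\ -\frac{2p-1}{1-p}+\mathcal{O}(n^{1-2p}), & \frac12<p<1.\end{cases} \]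
   Context: Bernoulli model (parameter $0<p<1$): a series-parallel network is a directed multigraph with a source and a sink; its size is its number of edges. At step $1$ it is a single edge from source to sink. At step $n\ge2$ one of the $n-1$ edges, say $(x,y)$, is chosen uniformly at random; independently, with probability $p$ an additional edge $(x,y)$ is added, and with probability $1-p$ the edge $(x,y)$ is replaced by $(x,z),(z,y)$ with $z$ a new node. Source-to-sink paths are directed paths from source to sink (parallel edges give distinct paths). $B_k(x_1,\dots,x_k)$ is the $k$-th complete Bell polynomial (with $B_0=1$), $H^{(m)}_n=\sum_{j=1}^n j^{-m}$, and for real $x$, $\binom{x}{k}=x(x-1)\cdots(x-k+1)/k!$. *)

theory Defs
  imports
    "HOL-Probability.Probability"
    "HOL-Computational_Algebra.Formal_Power_Series"
    "Graph_Theory.Arc_Walk"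
begin

text \<open>
  A network is a directed multigraph with numbered nodes and numbered edges. The source is
  node 0 and the sink is node 1 throughout; neither is ever removed by a growth step.
\<close>

type_synonym network = "(nat, nat) pre_digraph"

abbreviation (input) source :: nat where "source \<equiv> 0"
abbreviation (input) sink :: nat where "sink \<equiv> 1"

definition single_edge :: network where
  "single_edge = \<lparr>verts = {source, sink}, arcs = {0}, tail = (\<lambda>_. source), head = (\<lambda>_. sink)\<rparr>"

definition fresh :: "nat set \<Rightarrow> nat" where
  "fresh A = (LEAST z. z \<notin> A)"

definition double_edge :: "nat \<Rightarrow> network \<Rightarrow> network" where
  "double_edge e G = (let e' = fresh (arcs G) in
     G\<lparr>arcs := insert e' (arcs G),
       tail := (tail G)(e' := tail G e),
       head := (head G)(e' := head G e)\<rparr>)"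

text \<open>
  Replacing an edge \<open>e = (x, y)\<close> by \<open>(x, z)\<close> and \<open>(z, y)\<close>: the number \<open>e\<close> is reused for \<open>(x, z)\<close>,
  so that the tail of \<open>e\<close> is unchanged.
\<close>
definition subdivide_edge :: "nat \<Rightarrow> network \<Rightarrow> network" where
  "subdivide_edge e G = (let e' = fresh (arcs G); z = fresh (verts G) in
     G\<lparr>verts := insert z (verts G),
       arcs := insert e' (arcs G),
       tail := (tail G)(e' := z),
       head := (head G)(e := z, e' := head G e)\<rparr>)"

definition bernoulli_step :: "real \<Rightarrow> network \<Rightarrow> network pmf" where
  "bernoulli_step p G =
     bind_pmf (pmf_of_set (arcs G)) (\<lambda>e.
     bind_pmf (bernoulli_pmf p) (\<lambda>b.
     return_pmf (if b then double_edge e G else subdivide_edge e G)))"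

text \<open>
  The random network of size \<open>n\<close>, for \<open>n \<ge> 1\<close>: it arises from the single edge by \<open>n - 1\<close> steps.
\<close>
definition bernoulli_network :: "real \<Rightarrow> nat \<Rightarrow> network pmf" where
  "bernoulli_network p n = ((\<lambda>N. bind_pmf N (bernoulli_step p)) ^^ (n - 1)) (return_pmf single_edge)"

text \<open>Paths are lists of edges, so parallel edges give distinct paths.\<close>
definition num_paths :: "network \<Rightarrow> nat" where
  "num_paths G = card {es. pre_digraph.apath G source es sink}"

definition expected_paths :: "real \<Rightarrow> nat \<Rightarrow> real" where
  "expected_paths p n = measure_pmf.expectation (bernoulli_network p n) (\<lambda>G. real (num_paths G))"

text \<open>
  The complete Bell polynomials, by their exponential generating function
  \<open>exp (\<Sum>j\<ge>1. x j * t^j / j!) = (\<Sum>k. B\<^sub>k(x 1, \<dots>, x k) * t^k / k!)\<close>.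
  The value \<open>x 0\<close> is not used.
\<close>
definition complete_bell :: "nat \<Rightarrow> (nat \<Rightarrow> real) \<Rightarrow> real" where
  "complete_bell k x =
     fact k * fps_nth (fps_compose (fps_exp 1) (Abs_fps (\<lambda>j. if j = 0 then 0 else x j / fact j))) k"

definition gen_harm :: "nat \<Rightarrow> nat \<Rightarrow> real" where
  "gen_harm m n = (\<Sum>j=1..n. 1 / real j ^ m)"

definition growth_rate :: "real \<Rightarrow> real" where
  "growth_rate p =
     (if p = 1/2 then 1 / (1 - exp (-2))
      else inverse (1 - (p / (1 - p)) powr (1 / (1 - 2 * p))))"

end

theory Submission
  imports
    Defs
    "HOL-Complex_Analysis.Complex_Analysis"
    "HOL-Real_Asymp.Real_Asymp"
begin

text \<open>
  Let \<open>f\<close> be the power series with \<open>f(0) = 1\<close> and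
  \<open>f' = 2 * p * f / (1 - X) + (1 - p) * f\<^sup>2\<close>. For a network \<open>G\<close> with
  \<open>m\<close> edges, the expected number of paths after \<open>N\<close> further steps depends only on the lengths \<open>l\<close> of
  the paths of \<open>G\<close>: weighted with \<open>(m + N - 1) choose N\<close>, its generating function is
  \<open>\<Sum>f\<^sup>l * (1 - X)\<^sup>-\<^sup>(\<^sup>m\<^sup>-\<^sup>l\<^sup>)\<close>, summed over the paths of \<open>G\<close>, because one growth step
  acts on this sum as the derivative. For the single edge this gives \<open>f\<close> itself.
  The Bernoulli equation makes \<open>1 / f\<close> the explicit combination of \<open>v\<close> and
  \<open>v\<^sup>2\<^sup>p\<close> (for \<open>p = 1/2\<close>, of \<open>v\<close> and \<open>v * ln v\<close>), where \<open>v = 1 - z\<close>; expanding its inverse as a geometric series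
  gives the exact formulas.

  On the plane slit along \<open>v \<le> 0\<close>, \<open>1 / f\<close> has a single, simple zero, whose pole contributes
  \<open>growth_rate p ^ n / (1 - p)\<close>. After removing this pole and the leading singular
  term at \<open>v = 0\<close>, a function of size \<open>O(v\<^sup>-\<^sup>\<beta>)\<close> is left, whose coefficients are \<open>O(n\<^sup>\<beta>\<^sup>-\<^sup>1)\<close>. For
  \<open>p = 1/2\<close> the leading term is \<open>1 / v\<close> with the slowly varying factor frozen at \<open>v = 1 / n\<close>.
\<close>

section \<open>Networks and their source-to-sink paths\<close>

lemma fresh_notin: "finite A \<Longrightarrow> fresh A \<notin> A"
  unfolding fresh_def by (rule LeastI_ex) (rule ex_new_if_finite[OF infinite_UNIV_nat])

definition st_paths :: "network \<Rightarrow> nat list set" where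
  "st_paths G = {es. pre_digraph.apath G source es sink}"

text \<open>Invariant of the growth: finiteness makes \<open>fresh\<close> yield a new number, and a
  nonempty arc set makes the uniform choice of an edge meaningful.\<close>

definition valid_network :: "network \<Rightarrow> bool" where
  "valid_network G \<longleftrightarrow> fin_digraph G \<and> source \<in> verts G \<and> sink \<in> verts G \<and> arcs G \<noteq> {}"

lemma valid_networkD:
  assumes "valid_network G"
  shows "finite (arcs G)" "finite (verts G)" "wf_digraph G" "arcs G \<noteq> {}"
    "source \<in> verts G" "sink \<in> verts G" "card (arcs G) > 0"
  using assms fin_digraph.axioms(1) fin_digraph.finite_arcs fin_digraph.finite_verts
  by (auto simp: valid_network_def card_gt_0_iff)

text \<open>An \<open>apath\<close> repeats no vertex, and each arc contributes its tail to the
  vertex list, so a repeated arc would repeat its tail.\<close>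

lemma (in pre_digraph) apath_imp_distinct: "apath u es v \<Longrightarrow> distinct es"
  by (auto simp: apath_def awalk_verts_conv distinct_map split: if_splits)

lemma st_paths_distinct: "es \<in> st_paths G \<Longrightarrow> distinct es"
  by (auto simp: st_paths_def dest: pre_digraph.apath_imp_distinct)

lemma st_paths_arcs: "es \<in> st_paths G \<Longrightarrow> set es \<subseteq> arcs G"
  by (auto simp: st_paths_def pre_digraph.apath_def pre_digraph.awalk_def)

lemma finite_st_paths: "finite (arcs G) \<Longrightarrow> finite (st_paths G)"
  by (rule finite_subset[OF _ finite_subset_distinct[of "arcs G"]])
     (auto dest: st_paths_distinct st_paths_arcs)

lemma st_paths_length_le: "finite (arcs G) \<Longrightarrow> es \<in> st_paths G \<Longrightarrow> length es \<le> card (arcs G)"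
  by (metis card_mono distinct_card st_paths_arcs st_paths_distinct)

subsection \<open>Paths under the growth steps\<close>

lemma double_edge_sel:
  defines "e' G \<equiv> fresh (arcs G)"
  shows "verts (double_edge e G) = verts G" "arcs (double_edge e G) = insert (e' G) (arcs G)"
    "tail (double_edge e G) = (tail G)(e' G := tail G e)"
    "head (double_edge e G) = (head G)(e' G := head G e)"
  by (simp_all add: double_edge_def e'_def Let_def)

lemma subdivide_edge_sel:
  defines "e' G \<equiv> fresh (arcs G)" and "z G \<equiv> fresh (verts G)"
  shows "verts (subdivide_edge e G) = insert (z G) (verts G)"
    "arcs (subdivide_edge e G) = insert (e' G) (arcs G)"
    "tail (subdivide_edge e G) = (tail G)(e' G := z G)"
    "head (subdivide_edge e G) = (head G)(e := z G, e' G := head G e)"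
  by (simp_all add: subdivide_edge_def e'_def z_def Let_def)

lemma valid_single_edge: "valid_network single_edge"
  by (auto simp: valid_network_def single_edge_def fin_digraph_def wf_digraph_def fin_digraph_axioms_def)

lemma valid_double_edge: "valid_network G \<Longrightarrow> e \<in> arcs G \<Longrightarrow> valid_network (double_edge e G)"
  by (auto simp: valid_network_def fin_digraph_def wf_digraph_def fin_digraph_axioms_def double_edge_sel)

lemma valid_subdivide_edge: "valid_network G \<Longrightarrow> e \<in> arcs G \<Longrightarrow> valid_network (subdivide_edge e G)"
  by (auto simp: valid_network_def fin_digraph_def wf_digraph_def fin_digraph_axioms_def subdivide_edge_sel)

lemma card_arcs_double_edge:
  "finite (arcs G) \<Longrightarrow> card (arcs (double_edge e G)) = Suc (card (arcs G))"
  by (simp add: double_edge_sel fresh_notin)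

lemma card_arcs_subdivide_edge:
  "finite (arcs G) \<Longrightarrow> card (arcs (subdivide_edge e G)) = Suc (card (arcs G))"
  by (simp add: subdivide_edge_sel fresh_notin)

text \<open>The new arc has the endpoints of \<open>e\<close>, so renaming it to \<open>e\<close>
  leaves every visited vertex unchanged.\<close>

lemma awalk_verts_double_edge:
  "pre_digraph.awalk_verts (double_edge e G) u es =
     pre_digraph.awalk_verts G u (map (\<lambda>a. if a = fresh (arcs G) then e else a) es)"
proof (induction es arbitrary: u)
  case (Cons a es)
  then show ?case by (auto simp: pre_digraph.awalk_verts.simps double_edge_sel)
qed (simp add: pre_digraph.awalk_verts.simps)

lemma cas_double_edge:
  "pre_digraph.cas (double_edge e G) u es v =
     pre_digraph.cas G u (map (\<lambda>a. if a = fresh (arcs G) then e else a) es) v"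
proof (induction es arbitrary: u)
  case (Cons a es)
  then show ?case by (auto simp: pre_digraph.cas.simps double_edge_sel)
qed (simp add: pre_digraph.cas.simps)

lemma st_paths_double_edge_iff:
  assumes "e \<in> arcs G"
  shows "es \<in> st_paths (double_edge e G) \<longleftrightarrow> set es \<subseteq> insert (fresh (arcs G)) (arcs G) \<and>
     map (\<lambda>a. if a = fresh (arcs G) then e else a) es \<in> st_paths G"
  using assms
  by (auto simp: st_paths_def pre_digraph.apath_def pre_digraph.awalk_def awalk_verts_double_edge
       cas_double_edge double_edge_sel split: if_splits)

text \<open>A path cannot contain both parallel arcs, because they share their tail. So it either
  avoids the new arc and is a path of \<open>G\<close>, or arises from a path through
  \<open>e\<close> by exchanging \<open>e\<close> for the new arc.\<close>

lemma st_paths_double_edge: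
  assumes e: "e \<in> arcs G" and fin: "finite (arcs G)"
  shows "st_paths (double_edge e G) = st_paths G \<union>
     map (\<lambda>a. if a = e then fresh (arcs G) else a) ` {es \<in> st_paths G. e \<in> set es}"
    (is "?L = _ \<union> map ?s ` _")
proof -
  define e' where "e' = fresh (arcs G)"
  have e': "e' \<notin> arcs G" using fresh_notin[OF fin] by (simp add: e'_def)
  define r where "r a = (if a = e' then e else a)" for a
  define s where "s a = (if a = e then e' else a)" for a
  have iff: "es \<in> ?L \<longleftrightarrow> set es \<subseteq> insert e' (arcs G) \<and> map r es \<in> st_paths G" for es
    using st_paths_double_edge_iff[OF e] by (simp add: e'_def r_def[abs_def])
  have r_id: "map r es = es" if "e' \<notin> set es" for es
    using that by (intro map_idI) (auto simp: r_def)
  show ?thesis unfolding e'_def[symmetric] s_def[symmetric, abs_def]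
  proof (intro equalityI subsetI)
    fix es assume "es \<in> ?L"
    then have *: "set es \<subseteq> insert e' (arcs G)" "map r es \<in> st_paths G" by (auto simp: iff)
    show "es \<in> st_paths G \<union> map s ` {es \<in> st_paths G. e \<in> set es}"
    proof (cases "e' \<in> set es")
      case False
      then show ?thesis using * r_id by auto
    next
      case True
      \<comment> \<open>\<open>map r es\<close> is distinct because it is a path, so
        \<open>r\<close> merges no two arcs of \<open>es\<close>; with \<open>e'\<close> present,
        \<open>e\<close> is excluded.\<close>
      have "inj_on r (set es)"
        using st_paths_distinct[OF *(2)] by (simp add: distinct_map)
      then have "e \<notin> set es" using True e e' inj_onD[of r "set es" e e'] by (auto simp: r_def)
      then have "map s (map r es) = es"
        by (simp, intro map_idI) (auto simp: r_def s_def)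
      moreover have "e \<in> set (map r es)" using True by (force simp: r_def)
      ultimately show ?thesis using *(2)
        by (metis (mono_tags, lifting) UnI2 image_eqI mem_Collect_eq)
    qed
  next
    fix es assume "es \<in> st_paths G \<union> map s ` {es \<in> st_paths G. e \<in> set es}"
    then show "es \<in> ?L"
    proof
      assume A: "es \<in> st_paths G"
      then show ?thesis using st_paths_arcs[OF A] e' r_id[of es] by (metis iff subset_iff subset_insertI2)
    next
      assume "es \<in> map s ` {es \<in> st_paths G. e \<in> set es}"
      then obtain fs where fs: "es = map s fs" "fs \<in> st_paths G" by auto
      have "map r es = fs" unfolding fs(1) using st_paths_arcs[OF fs(2)] e'
        by (simp, intro map_idI) (auto simp: r_def s_def)
      then show ?thesis using fs st_paths_arcs[OF fs(2)] by (auto simp: iff s_def)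
    qed
  qed
qed

text \<open>Each path through \<open>e\<close> gains one parallel copy of the same length, and the
  copies are new because they contain the fresh arc.\<close>

lemma sum_st_paths_double_edge:
  fixes \<phi> :: "nat \<Rightarrow> 'a::comm_semiring_1"
  assumes e: "e \<in> arcs G" and fin: "finite (arcs G)"
  shows "(\<Sum>es\<in>st_paths (double_edge e G). \<phi> (length es)) =
    (\<Sum>es\<in>st_paths G. (if e \<in> set es then 2 else 1) * \<phi> (length es))"
proof -
  let ?s = "\<lambda>a. if a = e then fresh (arcs G) else a"
  let ?A = "{es \<in> st_paths G. e \<in> set es}"
  have e': "fresh (arcs G) \<notin> arcs G" by (rule fresh_notin[OF fin])
  have "inj_on ?s (arcs G)" using e' by (auto simp: inj_on_def)
  then have inj: "inj_on (map ?s) ?A"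
    by (intro inj_on_subset[OF inj_on_mapI[of ?s "lists (arcs G)"]])
       (use st_paths_arcs in \<open>auto intro: inj_on_subset\<close>)
  have disj: "st_paths G \<inter> map ?s ` ?A = {}"
    using e' by (auto dest!: st_paths_arcs)
  have "(\<Sum>es\<in>st_paths (double_edge e G). \<phi> (length es)) =
      (\<Sum>es\<in>st_paths G. \<phi> (length es)) + (\<Sum>es\<in>map ?s ` ?A. \<phi> (length es))"
    unfolding st_paths_double_edge[OF e fin]
    by (intro sum.union_disjoint disj) (auto simp: finite_st_paths[OF fin])
  also have "(\<Sum>es\<in>map ?s ` ?A. \<phi> (length es)) = (\<Sum>es\<in>?A. \<phi> (length es))"
    by (subst sum.reindex[OF inj]) simp
  also have "\<dots> = (\<Sum>es\<in>st_paths G. if e \<in> set es then \<phi> (length es) else 0)"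
    by (rule sum.inter_filter[OF finite_st_paths[OF fin]])
  finally show ?thesis
    by (simp add: sum.distrib[symmetric] cong: sum.cong)
       (intro sum.cong, auto simp: mult_2)
qed

text \<open>The effect of \<^const>\<open>subdivide_edge\<close> on the arc list of a path.\<close>
definition split_arc :: "nat \<Rightarrow> nat \<Rightarrow> nat list \<Rightarrow> nat list" where
  "split_arc e e' es = concat (map (\<lambda>a. if a = e then [e, e'] else [a]) es)"

lemma split_arc_simps [simp]:
  "split_arc e e' [] = []"
  "split_arc e e' (a # es) = (if a = e then [e, e'] else [a]) @ split_arc e e' es"
  by (simp_all add: split_arc_def)

lemma length_split_arc: "distinct es \<Longrightarrow> length (split_arc e e' es) = length es + (if e \<in> set es then 1 else 0)"
  by (induction es) auto

text \<open>Deleting the new arc undoes \<open>split_arc\<close>; this left inverse gives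
  injectivity on paths.\<close>

lemma filter_split_arc: "e' \<notin> set es \<Longrightarrow> e \<noteq> e' \<Longrightarrow> filter (\<lambda>a. a \<noteq> e') (split_arc e e' es) = es"
  by (induction es) auto

lemma set_split_arc: "set (split_arc e e' es) = set es \<union> (if e \<in> set es then {e'} else {})"
  by (induction es) auto

section \<open>Paths after subdividing an edge\<close>

context
  fixes G :: network and e e' z :: nat and G' :: network
  assumes G: "valid_network G" and e: "e \<in> arcs G"
  defines "e' \<equiv> fresh (arcs G)" and "z \<equiv> fresh (verts G)" and "G' \<equiv> subdivide_edge e G"
begin

lemma e'_notin: "e' \<notin> arcs G" and z_notin: "z \<notin> verts G"
  using fresh_notin valid_networkD[OF G] by (auto simp: e'_def z_def)

lemma wf_arcs: "a \<in> arcs G \<Longrightarrow> tail G a \<in> verts G \<and> head G a \<in> verts G"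
  using valid_networkD(3)[OF G] by (simp add: wf_digraph.head_in_verts wf_digraph.tail_in_verts)

lemma G'_sel: "verts G' = insert z (verts G)" "arcs G' = insert e' (arcs G)"
   "tail G' = (tail G)(e' := z)" "head G' = (head G)(e := z, e' := head G e)"
  by (simp_all add: G'_def e'_def z_def subdivide_edge_sel)

lemma e_ne_e': "e \<noteq> e'" using e e'_notin by auto

lemma cas_split_arc:
  assumes "set es \<subseteq> arcs G"
  shows "pre_digraph.cas G' u (split_arc e e' es) v = pre_digraph.cas G u es v"
  using assms
proof (induction es arbitrary: u)
  case (Cons a es)
  then show ?case using e'_notin e_ne_e' by (auto simp: pre_digraph.cas.simps G'_sel)
qed (simp add: pre_digraph.cas.simps)

lemma set_awalk_verts_split_arc:
  assumes "set es \<subseteq> arcs G"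
  shows "set (pre_digraph.awalk_verts G' u (split_arc e e' es)) =
    set (pre_digraph.awalk_verts G u es) \<union> (if e \<in> set es then {z} else {})"
  using assms
proof (induction es arbitrary: u)
  case (Cons a es)
  then show ?case using e'_notin e_ne_e' by (auto simp: pre_digraph.awalk_verts.simps G'_sel)
qed (simp add: pre_digraph.awalk_verts.simps)

lemma awalk_verts_subset:
  assumes "set es \<subseteq> arcs G" "u \<in> verts G"
  shows "set (pre_digraph.awalk_verts G u es) \<subseteq> verts G"
  using wf_digraph.awalk_verts_in_verts[OF valid_networkD(3)[OF G]] assms by blast

text \<open>The node \<open>z\<close> is visited once for each occurrence of \<open>e\<close>, so it
  can repeat only if \<open>e\<close> does, and then the tail of \<open>e\<close> repeats in
  \<open>G\<close> as well.\<close>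

lemma distinct_awalk_verts_split_arc:
  assumes "set es \<subseteq> arcs G" "u \<in> verts G"
  shows "distinct (pre_digraph.awalk_verts G' u (split_arc e e' es)) \<longleftrightarrow>
    distinct (pre_digraph.awalk_verts G u es)"
  using assms
proof (induction es arbitrary: u)
  case Nil
  then show ?case by (simp add: pre_digraph.awalk_verts.simps)
next
  case (Cons a es)
  have IH: "distinct (pre_digraph.awalk_verts G' (head G a) (split_arc e e' es)) \<longleftrightarrow>
    distinct (pre_digraph.awalk_verts G (head G a) es)"
    using Cons wf_arcs by auto
  have sub: "set (pre_digraph.awalk_verts G (head G a) es) \<subseteq> verts G"
    using awalk_verts_subset Cons.prems wf_arcs by auto
  have ta: "tail G a \<in> verts G" using Cons.prems wf_arcs by auto
  have eq: "set (pre_digraph.awalk_verts G' (head G a) (split_arc e e' es)) =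
    set (pre_digraph.awalk_verts G (head G a) es) \<union> (if e \<in> set es then {z} else {})"
    using Cons.prems by (intro set_awalk_verts_split_arc) auto
  \<comment> \<open>When \<open>a = e\<close> occurs again in \<open>es\<close>, its tail appears a
    second time, so both sides are false.\<close>
  have arc: "tail G e \<in> set (pre_digraph.awalk_verts G (head G a) es)" if "e \<in> set es"
    by (rule wf_digraph.awalk_verts_arc1[OF valid_networkD(3)[OF G] that])
  have "a \<noteq> e'" using Cons.prems e'_notin by auto
  then show ?case using IH sub ta eq arc z_notin e_ne_e'
    by (auto simp: pre_digraph.awalk_verts.simps G'_sel split: if_splits)
qed

text \<open>Only \<open>e\<close> enters \<open>z\<close> and only \<open>e'\<close> leaves it, so a
  walk with both ends different from \<open>z\<close> must traverse \<open>e\<close> and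
  \<open>e'\<close> in succession. The induction is on the length because two arcs are consumed at
  once when the walk meets \<open>e\<close>.\<close>

lemma walk_is_split_arc:
  assumes "pre_digraph.cas G' u es v" "set es \<subseteq> arcs G'" "u \<noteq> z" "v \<noteq> z"
  shows "\<exists>fs. es = split_arc e e' fs \<and> set fs \<subseteq> arcs G"
  using assms
proof (induction "length es" arbitrary: es u rule: less_induct)
  case less
  show ?case
  proof (cases es)
    case Nil
    then show ?thesis by (intro exI[of _ "[]"]) simp
  next
    case (Cons a es1)
    have "a \<noteq> e'" using less.prems Cons by (auto simp: pre_digraph.cas.simps G'_sel)
    then have a: "a \<in> arcs G" using less.prems Cons by (auto simp: G'_sel)
    show ?thesis
    proof (cases "a = e")
      case False
      have "pre_digraph.cas G' (head G a) es1 v"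
        using less.prems Cons False \<open>a \<noteq> e'\<close> by (auto simp: pre_digraph.cas.simps G'_sel)
      moreover have "head G a \<noteq> z" using wf_arcs[OF a] z_notin by auto
      ultimately obtain fs where "es1 = split_arc e e' fs" "set fs \<subseteq> arcs G"
        using less.hyps[of es1 "head G a"] less.prems Cons by auto
      then show ?thesis using False a Cons by (intro exI[of _ "a # fs"]) auto
    next
      case True
      then have c: "pre_digraph.cas G' z es1 v"
        using less.prems Cons \<open>a \<noteq> e'\<close> by (auto simp: pre_digraph.cas.simps G'_sel)
      then obtain b es2 where es1: "es1 = b # es2"
        using less.prems by (cases es1) (auto simp: pre_digraph.cas.simps)
      have "b = e'"
      proof (rule ccontr)
        assume "b \<noteq> e'"
        then show False using c less.prems Cons es1 wf_arcs[of b] z_notin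
          by (auto simp: pre_digraph.cas.simps G'_sel)
      qed
      then have "pre_digraph.cas G' (head G e) es2 v"
        using c es1 e_ne_e' by (auto simp: pre_digraph.cas.simps G'_sel)
      moreover have "head G e \<noteq> z" using wf_arcs[OF e] z_notin by auto
      ultimately obtain fs where "es2 = split_arc e e' fs" "set fs \<subseteq> arcs G"
        using less.hyps[of es2 "head G e"] less.prems Cons es1 by auto
      then show ?thesis using True a Cons es1 \<open>b = e'\<close> by (intro exI[of _ "e # fs"]) auto
    qed
  qed
qed

lemma st_paths_subdivide_edge: "st_paths G' = split_arc e e' ` st_paths G"
proof -
  have vs: "source \<in> verts G" "sink \<in> verts G" "source \<noteq> z" "sink \<noteq> z"
    using valid_networkD[OF G] z_notin by metis+
  have iff: "split_arc e e' fs \<in> st_paths G' \<longleftrightarrow> fs \<in> st_paths G" if "set fs \<subseteq> arcs G" for fs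
    using that vs cas_split_arc[OF that] distinct_awalk_verts_split_arc[OF that vs(1)]
    by (auto simp: st_paths_def pre_digraph.apath_def pre_digraph.awalk_def G'_sel set_split_arc)
  have "es \<in> split_arc e e' ` st_paths G" if es: "es \<in> st_paths G'" for es
  proof -
    have "\<exists>fs. es = split_arc e e' fs \<and> set fs \<subseteq> arcs G"
      using es vs by (intro walk_is_split_arc[of source _ sink])
        (auto simp: st_paths_def pre_digraph.apath_def pre_digraph.awalk_def)
    then show ?thesis using iff es by blast
  qed
  then show ?thesis using iff st_paths_arcs by blast
qed

lemma sum_st_paths_subdivide_edge:
  "(\<Sum>es\<in>st_paths G'. \<phi> (length es)) =
    (\<Sum>es\<in>st_paths G. \<phi> (if e \<in> set es then Suc (length es) else length es))"
proof -
  have inj: "inj_on (split_arc e e') (st_paths G)"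
    by (rule inj_on_inverseI[of _ "filter (\<lambda>a. a \<noteq> e')"])
       (use st_paths_arcs e'_notin e_ne_e' in \<open>auto intro!: filter_split_arc\<close>)
  show ?thesis unfolding st_paths_subdivide_edge
    by (subst sum.reindex[OF inj])
       (auto intro!: sum.cong simp: length_split_arc st_paths_distinct)
qed

end

subsection \<open>The expected number of paths\<close>

abbreviation grow :: "real \<Rightarrow> nat \<Rightarrow> network pmf \<Rightarrow> network pmf" where
  "grow p N \<equiv> (\<lambda>M. bind_pmf M (bernoulli_step p)) ^^ N"

text \<open>Growth is linear in the initial distribution, which permits conditioning on the first
  step instead of the last.\<close>

lemma grow_bind: "grow p N (bind_pmf M h) = bind_pmf M (\<lambda>x. grow p N (h x))"
  by (induction N) (simp_all add: bind_assoc_pmf)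

lemma set_bernoulli_step:
  assumes "valid_network G" "H \<in> set_pmf (bernoulli_step p G)"
  shows "\<exists>e\<in>arcs G. H = double_edge e G \<or> H = subdivide_edge e G"
  using assms valid_networkD[OF assms(1)]
  by (auto simp: bernoulli_step_def split: if_splits)

lemma finite_set_bernoulli_step:
  assumes "valid_network G"
  shows "finite (set_pmf (bernoulli_step p G))"
  by (rule finite_subset[of _ "(\<lambda>e. double_edge e G) ` arcs G \<union> (\<lambda>e. subdivide_edge e G) ` arcs G"])
     (use set_bernoulli_step[OF assms] valid_networkD[OF assms] in auto)

text \<open>The support stays finite, so the expectations below are finite sums.\<close>

lemma finite_set_grow:
  assumes "valid_network G"
  shows "finite (set_pmf (grow p N (return_pmf G))) \<and>
    (\<forall>H\<in>set_pmf (grow p N (return_pmf G)). valid_network H)"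
proof (induction N)
  case (Suc N)
  then show ?case using finite_set_bernoulli_step
    by (auto dest!: set_bernoulli_step[rotated] intro: valid_double_edge valid_subdivide_edge)
qed (use assms in auto)

text \<open>First-step analysis: the first edge and the first coin are averaged out, with
  \<open>N\<close> steps left. Multiplying by the number of arcs clears the uniform weights.\<close>

lemma expectation_grow_Suc:
  fixes h :: "network \<Rightarrow> real"
  assumes G: "valid_network G" and p: "0 \<le> p" "p \<le> 1"
  defines "E \<equiv> \<lambda>N G. measure_pmf.expectation (grow p N (return_pmf G)) h"
  shows "real (card (arcs G)) * E (Suc N) G =
    (\<Sum>e\<in>arcs G. p * E N (double_edge e G) + (1 - p) * E N (subdivide_edge e G))"
proof -
  have "grow p (Suc N) (return_pmf G) = grow p N (bernoulli_step p G)"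
    by (simp add: funpow_Suc_right bind_return_pmf del: funpow.simps)
  also have "\<dots> = bind_pmf (pmf_of_set (arcs G)) (\<lambda>e. bind_pmf (bernoulli_pmf p) (\<lambda>b.
      grow p N (return_pmf (if b then double_edge e G else subdivide_edge e G))))"
    by (simp add: bernoulli_step_def grow_bind)
  finally have *: "grow p (Suc N) (return_pmf G) = \<dots>" .
  have fin: "finite (set_pmf (grow p N (return_pmf (if b then double_edge e G else subdivide_edge e G))))"
    if "e \<in> arcs G" for b e
    using finite_set_grow valid_double_edge valid_subdivide_edge G that by simp
  have "E (Suc N) G = (\<Sum>e\<in>arcs G. measure_pmf.expectation (bind_pmf (bernoulli_pmf p) (\<lambda>b.
      grow p N (return_pmf (if b then double_edge e G else subdivide_edge e G)))) h /\<^sub>R real (card (arcs G)))"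
    unfolding E_def * using valid_networkD[OF G] fin
    by (intro pmf_expectation_bind_pmf_of_set) auto
  also have "\<dots> = (\<Sum>e\<in>arcs G. (p * E N (double_edge e G) + (1 - p) * E N (subdivide_edge e G)) / real (card (arcs G)))"
  proof (intro sum.cong refl)
    fix e assume e: "e \<in> arcs G"
    have "measure_pmf.expectation (bind_pmf (bernoulli_pmf p) (\<lambda>b.
      grow p N (return_pmf (if b then double_edge e G else subdivide_edge e G)))) h =
      (\<Sum>b\<in>UNIV. pmf (bernoulli_pmf p) b *\<^sub>R measure_pmf.expectation
         (grow p N (return_pmf (if b then double_edge e G else subdivide_edge e G))) h)"
      using fin[OF e] by (intro pmf_expectation_bind) auto
    also have "\<dots> = p * E N (double_edge e G) + (1 - p) * E N (subdivide_edge e G)"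
      using p by (simp add: UNIV_bool E_def)
    finally show "measure_pmf.expectation (bind_pmf (bernoulli_pmf p) (\<lambda>b.
      grow p N (return_pmf (if b then double_edge e G else subdivide_edge e G)))) h /\<^sub>R real (card (arcs G)) =
      (p * E N (double_edge e G) + (1 - p) * E N (subdivide_edge e G)) / real (card (arcs G))"
      by (simp add: divide_inverse mult.commute)
  qed
  finally show ?thesis using valid_networkD[OF G]
    by (simp flip: sum_divide_distrib)
qed

text \<open>
  By the Polya urn argument the growth of the \<open>m\<close> edges is uniform over all compositions, so a path of
  length \<open>l\<close> contributes \<open>f ^ l * (1 / (1 - X)) ^ (m - l)\<close> to the generating function of
  \<open>((m + N - 1) choose N)\<close> times the expected number of paths after \<open>N\<close> further steps.
\<close>
lemma expectation_grow_num_paths: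
  fixes f :: "real fps"
  assumes p: "0 \<le> p" "p \<le> 1" and f0: "fps_nth f 0 = 1"
    and ode: "fps_deriv f = fps_const (2 * p) * f * inverse (1 - fps_X) + fps_const (1 - p) * f ^ 2"
    and G: "valid_network G"
  shows "real ((card (arcs G) + N - 1) choose N) *
      measure_pmf.expectation (grow p N (return_pmf G)) (\<lambda>G. real (num_paths G)) =
    fps_nth (\<Sum>es\<in>st_paths G. f ^ length es * inverse (1 - fps_X) ^ (card (arcs G) - length es)) N"
  using G
proof (induction N arbitrary: G)
  case 0
  show ?case using f0 by (simp add: num_paths_def st_paths_def fps_sum_nth fps_power_zeroth)
next
  case (Suc N)
  define g :: "real fps" where "g = inverse (1 - fps_X)"
  define m where "m = card (arcs G)"
  define \<psi> where "\<psi> m l = f ^ l * g ^ (m - l)" for m l :: nat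
  define \<Phi> where "\<Phi> G = (\<Sum>es\<in>st_paths G. \<psi> (card (arcs G)) (length es))" for G
  note G = Suc.prems
  note V = valid_networkD[OF G]
  define E where "E N G = measure_pmf.expectation (grow p N (return_pmf G)) (\<lambda>G. real (num_paths G))" for N G
  have IH: "real ((card (arcs H) + N - 1) choose N) * E N H = fps_nth (\<Phi> H) N" if "valid_network H" for H
    using Suc.IH[OF that] by (simp add: E_def \<Phi>_def \<psi>_def g_def)
  have mpos: "m > 0" using V by (simp add: m_def)
  have g': "fps_deriv g = g ^ 2"
    by (simp add: g_def fps_inverse_deriv)
  \<comment> \<open>Product rule: an arc on the path accounts for one factor \<open>f\<close>, whose
    derivative \<open>2 p f g + (1 - p) f^2\<close> reflects doubling and lengthening of the path.
    An arc off the path accounts for one factor \<open>g\<close> with \<open>g' = g^2\<close>; there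
    \<open>p\<close> and \<open>1 - p\<close> add up to 1.\<close>
  have d\<psi>: "fps_deriv (\<psi> m (length es)) = (\<Sum>e\<in>arcs G.
      fps_const p * ((if e \<in> set es then 2 else 1) * \<psi> (Suc m) (length es)) +
      fps_const (1 - p) * \<psi> (Suc m) (if e \<in> set es then Suc (length es) else length es))"
    if es: "es \<in> st_paths G" for es
  proof -
    define l where "l = length es"
    have lm: "l \<le> m" using st_paths_length_le[OF V(1) es] by (simp add: l_def m_def)
    define k where "k = m - l"
    have k: "Suc m - l = Suc k" "Suc m - Suc l = k" "m - l = k" using lm by (auto simp: k_def)
    have deriv_pow: "fps_deriv (h ^ n) = of_nat n * (fps_deriv h * h ^ (n - 1))" for h :: "real fps" and n
    proof (induction n)
      case (Suc n)
      then show ?case by (cases n) (simp_all add: algebra_simps)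
    qed simp
    have c: "fps_const (1 - p) = 1 - fps_const p" "fps_const (2 * p) = 2 * fps_const p"
      by (simp_all add: fps_const_sub fps_eq_iff numeral_fps_const)
    have "fps_deriv (f ^ l) = of_nat l * f ^ l * (fps_const (2*p) * g + fps_const (1 - p) * f)"
      unfolding deriv_pow ode g_def[symmetric]
      by (cases l) (simp_all add: power2_eq_square algebra_simps del: of_nat_Suc)
    moreover have "fps_deriv (g ^ k) = of_nat k * g ^ Suc k"
      unfolding deriv_pow g'
      by (cases k) (simp_all add: power2_eq_square algebra_simps del: of_nat_Suc)
    ultimately have "fps_deriv (\<psi> m l) =
       of_nat l * f ^ l * (fps_const (2*p) * g + fps_const (1 - p) * f) * g ^ k +
       f ^ l * (of_nat k * g ^ Suc k)"
      by (simp add: \<psi>_def k)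
    also have "\<dots> = of_nat l * (fps_const p * (2 * \<psi> (Suc m) l) + fps_const (1 - p) * \<psi> (Suc m) (Suc l)) +
        of_nat k * (fps_const p * \<psi> (Suc m) l + fps_const (1 - p) * \<psi> (Suc m) l)"
      unfolding c by (simp add: \<psi>_def k algebra_simps)
    also have "\<dots> = (\<Sum>e\<in>set es. fps_const p * (2 * \<psi> (Suc m) l) + fps_const (1 - p) * \<psi> (Suc m) (Suc l)) +
        (\<Sum>e\<in>arcs G - set es. fps_const p * \<psi> (Suc m) l + fps_const (1 - p) * \<psi> (Suc m) l)"
      using st_paths_distinct[OF es] st_paths_arcs[OF es] V(1)
      by (simp add: distinct_card card_Diff_subset k_def l_def m_def)
    also have "\<dots> = (\<Sum>e\<in>arcs G.
      fps_const p * ((if e \<in> set es then 2 else 1) * \<psi> (Suc m) l) +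
      fps_const (1 - p) * \<psi> (Suc m) (if e \<in> set es then Suc l else l))"
      unfolding sum.subset_diff[OF st_paths_arcs[OF es] V(1)] add.commute[of "sum _ (set es)"]
      by (intro arg_cong2[of _ _ _ _ "(+)"] sum.cong) auto
    finally show ?thesis unfolding l_def .
  qed
  have d\<Phi>: "fps_deriv (\<Phi> G) = (\<Sum>e\<in>arcs G. fps_const p * \<Phi> (double_edge e G) + fps_const (1 - p) * \<Phi> (subdivide_edge e G))"
  proof -
    have "fps_deriv (\<Phi> G) = (\<Sum>es\<in>st_paths G. \<Sum>e\<in>arcs G.
      fps_const p * ((if e \<in> set es then 2 else 1) * \<psi> (Suc m) (length es)) +
      fps_const (1 - p) * \<psi> (Suc m) (if e \<in> set es then Suc (length es) else length es))"
      by (simp add: \<Phi>_def m_def[symmetric] fps_deriv_sum d\<psi> cong: sum.cong)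
    also have "\<dots> = (\<Sum>e\<in>arcs G. \<Sum>es\<in>st_paths G.
      fps_const p * ((if e \<in> set es then 2 else 1) * \<psi> (Suc m) (length es)) +
      fps_const (1 - p) * \<psi> (Suc m) (if e \<in> set es then Suc (length es) else length es))"
      by (rule sum.swap)
    also have "\<dots> = (\<Sum>e\<in>arcs G. fps_const p * \<Phi> (double_edge e G) + fps_const (1 - p) * \<Phi> (subdivide_edge e G))"
      using V(1) G
      by (intro sum.cong refl)
         (simp add: \<Phi>_def card_arcs_double_edge card_arcs_subdivide_edge m_def[symmetric]
           sum_st_paths_double_edge sum_st_paths_subdivide_edge sum.distrib sum_distrib_left)
    finally show ?thesis .
  qed
  have "real (Suc N) * fps_nth (\<Phi> G) (Suc N) = fps_nth (fps_deriv (\<Phi> G)) N" by simp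
  also have "\<dots> = (\<Sum>e\<in>arcs G. p * fps_nth (\<Phi> (double_edge e G)) N + (1 - p) * fps_nth (\<Phi> (subdivide_edge e G)) N)"
    unfolding d\<Phi> by (simp add: fps_sum_nth)
  also have "\<dots> = (\<Sum>e\<in>arcs G. real ((m + N) choose N) * (p * E N (double_edge e G) + (1 - p) * E N (subdivide_edge e G)))"
    using V(1) G
    by (intro sum.cong refl)
       (simp flip: IH[OF valid_double_edge] IH[OF valid_subdivide_edge]
         add: card_arcs_double_edge card_arcs_subdivide_edge m_def[symmetric] algebra_simps)
  also have "\<dots> = real ((m + N) choose N) * (real m * E (Suc N) G)"
    using expectation_grow_Suc[OF G p] unfolding E_def m_def by (simp add: sum_distrib_left)
  also have "\<dots> = real (m * ((m + N) choose N)) * E (Suc N) G" by simp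
  \<comment> \<open>The binomial weights are chosen for this identity: it turns the factor
    \<open>m\<close> from the uniform choice into the weight belonging to \<open>m\<close> arcs and
    \<open>N + 1\<close> steps.\<close>
  also have "m * ((m + N) choose N) = Suc N * ((m + N) choose Suc N)"
    using binomial_absorb_comp[of "m + N" N] binomial_absorption[of N "m + N"] by simp
  finally have "real (Suc N) * fps_nth (\<Phi> G) (Suc N) = real (Suc N) * (real ((m + N) choose Suc N) * E (Suc N) G)"
    by (simp only: of_nat_mult mult.assoc)
  then have "fps_nth (\<Phi> G) (Suc N) = real ((m + N) choose Suc N) * E (Suc N) G"
    by (simp del: of_nat_Suc)
  then show ?case by (simp add: \<Phi>_def \<psi>_def g_def m_def E_def)
qed

lemma st_paths_single_edge: "st_paths single_edge = {[0]}"
proof -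
  have "es = [0]" if "pre_digraph.cas single_edge 0 es 1" "set es \<subseteq> {0}" for es
  proof (cases es)
    case (Cons a fs)
    then show ?thesis using that
      by (cases fs) (auto simp: pre_digraph.cas.simps single_edge_def)
  qed (use that in \<open>auto simp: pre_digraph.cas.simps\<close>)
  then show ?thesis
    by (auto simp: st_paths_def pre_digraph.apath_def pre_digraph.awalk_def single_edge_def
        pre_digraph.cas.simps pre_digraph.awalk_verts.simps)
qed

text \<open>For the single edge the weight \<open>(1 + N - 1) choose N\<close> is 1 and the only
  path has length 1, so the sum over paths is \<open>f\<close> itself.\<close>

lemma expected_paths_eq_fps_nth:
  fixes f :: "real fps"
  assumes p: "0 \<le> p" "p \<le> 1" and f0: "fps_nth f 0 = 1"
    and ode: "fps_deriv f = fps_const (2 * p) * f * inverse (1 - fps_X) + fps_const (1 - p) * f ^ 2"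
  shows "expected_paths p n = fps_nth f (n - 1)"
  using expectation_grow_num_paths[OF assms valid_single_edge, of "n - 1"]
  by (simp add: expected_paths_def bernoulli_network_def st_paths_single_edge)
     (simp add: single_edge_def)

subsection \<open>Exact formulas\<close>

definition fps_one_minus_powr :: "'a::field_char_0 \<Rightarrow> 'a fps" where
  "fps_one_minus_powr a = fps_binomial a oo (- fps_X)"

lemma fps_one_minus_powr_nth [simp]: "fps_nth (fps_one_minus_powr a) n = (-1) ^ n * (a gchoose n)"
  by (simp add: fps_one_minus_powr_def fps_compose_uminus')

lemma fps_one_minus_powr_add: "fps_one_minus_powr (a + b) = fps_one_minus_powr a * fps_one_minus_powr b"
  by (simp add: fps_one_minus_powr_def fps_binomial_add_mult fps_compose_mult_distrib)

lemma fps_one_minus_powr_power: "fps_one_minus_powr a ^ n = fps_one_minus_powr (of_nat n * a)"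
  by (simp add: fps_one_minus_powr_def fps_compose_power fps_binomial_power)

lemma fps_one_minus_powr_0 [simp]: "fps_one_minus_powr 0 = 1"
  by (simp add: fps_one_minus_powr_def)

lemma fps_one_minus_powr_1 [simp]: "fps_one_minus_powr 1 = 1 - fps_X"
  by (simp add: fps_one_minus_powr_def fps_binomial_1 fps_compose_add_distrib)

lemma inverse_one_minus_fps_X: "inverse (1 - fps_X) = fps_one_minus_powr (-1 :: 'a::field_char_0)"
proof (rule fps_inverse_unique)
  show "(1 - fps_X) * fps_one_minus_powr (- 1) = (1 :: 'a fps)"
    by (metis fps_one_minus_powr_0 fps_one_minus_powr_1 fps_one_minus_powr_add right_minus)
qed

lemma fps_deriv_one_minus_powr:
  "fps_deriv (fps_one_minus_powr a) = - fps_const a * fps_one_minus_powr (a - 1 :: 'a::field_char_0)"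
proof -
  have "fps_deriv (fps_binomial a) = fps_const a * (fps_binomial a * fps_binomial (- 1))"
    by (simp add: fps_binomial_deriv fps_binomial_minus_one fps_divide_unit mult.assoc)
  then show ?thesis
    by (simp add: fps_one_minus_powr_def fps_compose_deriv fps_compose_mult_distrib fps_binomial_add_mult[of a "-1", simplified] flip: fps_const_neg)
qed

section \<open>Linearisation, and the exact formula for \<open>p\<close> other than
  \<open>1/2\<close>\<close>

text \<open>The substitution \<open>f = 1 / U\<close> turns the Bernoulli equation for
  \<open>f\<close> into a linear one for \<open>U\<close>.\<close>

lemma inverse_fps_riccati:
  fixes U :: "'a::field_char_0 fps"
  assumes U0: "fps_nth U 0 = 1"
    and dU: "fps_deriv U = - (fps_const (2 * p) * inverse (1 - fps_X) * U) - fps_const (1 - p)"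
  shows "fps_deriv (inverse U) = fps_const (2 * p) * inverse U * inverse (1 - fps_X) + fps_const (1 - p) * inverse U ^ 2"
proof -
  have "U * inverse U = 1" using U0 by (simp add: inverse_mult_eq_1')
  then have "inverse U ^ 2 * U = inverse U" by (simp add: power2_eq_square mult.assoc mult.commute)
  moreover have "fps_deriv (inverse U) = - fps_deriv U * inverse U ^ 2"
    using U0 by (simp add: fps_inverse_deriv)
  ultimately show ?thesis unfolding dU by (simp add: algebra_simps)
qed

text \<open>Geometric expansion: \<open>W\<close> has no constant term, so \<open>W ^ k\<close> has
  no terms below degree \<open>k\<close> and the sum may stop at \<open>m\<close>.\<close>

lemma inverse_one_minus_fps_nth:
  fixes W :: "'a::field fps"
  assumes W0: "fps_nth W 0 = 0"
  shows "fps_nth (A * inverse (1 - W)) m = (\<Sum>k=0..m. fps_nth (A * W ^ k) m)"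
proof -
  have *: "I = S + P * I" if "I * V = 1" "1 = V * S + P" for I V S P :: "'a fps"
  proof -
    have "I = I * (V * S + P)" by (simp flip: that(2))
    also have "\<dots> = I * V * S + P * I" by (simp add: distrib_left mult_ac)
    finally show ?thesis by (simp add: that(1))
  qed
  have "inverse (1 - W) * (1 - W) = 1" using W0 by (simp add: inverse_mult_eq_1)
  moreover have "1 = (1 - W) * (\<Sum>k<Suc m. W ^ k) + W ^ Suc m"
    by (simp only: one_diff_power_eq[of W "Suc m", symmetric] diff_add_cancel)
  ultimately have "inverse (1 - W) = (\<Sum>k<Suc m. W ^ k) + W ^ Suc m * inverse (1 - W)"
    by (rule *)
  then have "A * inverse (1 - W) = A * ((\<Sum>k<Suc m. W ^ k) + W ^ Suc m * inverse (1 - W))"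
    by (rule arg_cong)
  also have "\<dots> = (\<Sum>k=0..m. A * W ^ k) + W ^ Suc m * (A * inverse (1 - W))"
    by (simp only: distrib_left sum_distrib_left mult.left_commute atLeast0AtMost lessThan_Suc_atMost)
  finally have "fps_nth (A * inverse (1 - W)) m = fps_nth (\<dots>) m"
    by (rule arg_cong)
  moreover have "fps_nth (W ^ Suc m * (A * inverse (1 - W))) m = 0"
    using startsby_zero_power_prefix[OF W0, of "Suc m"] by (simp add: fps_mult_nth del: power_Suc)
  ultimately show ?thesis
    by (simp only: fps_add_nth fps_sum_nth add_0_right)
qed

text \<open>The linear equation is solved by
  \<open>U = (1 - q)(1 - X) + q (1 - X)^(2p) = (1 - X)(1 - W)\<close>. Expanding
  \<open>1 / (1 - W)\<close> geometrically and each \<open>W ^ k\<close> by the binomial theorem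
  leaves powers \<open>(1 - X)^((2p - 1) j - 1)\<close>, whose coefficients are binomial.\<close>

lemma expected_paths_exact:
  fixes p :: real
  assumes p: "0 \<le> p" "p \<le> 1" "p \<noteq> 1/2" and n: "n \<ge> 1"
  shows "expected_paths p n = (\<Sum>j=0..n-1. (-1) ^ (n + j - 1) * (((2 * p - 1) * real j - 1) gchoose (n - 1)) *
              (\<Sum>k=0..n-1. real (k choose j) * (p / (2 * p - 1)) ^ k))"
proof -
  define q where "q = p / (2 * p - 1)"
  define m where "m = n - 1"
  let ?w = "fps_one_minus_powr :: real \<Rightarrow> real fps"
  define U where "U = fps_const (1 - q) * ?w 1 + fps_const q * ?w (2 * p)"
  define W where "W = fps_const q * (1 - ?w (2 * p - 1))"
  \<comment> \<open>This relation fixes \<open>q\<close>: it makes the inhomogeneous term of the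
    equation for \<open>U\<close> equal to \<open>- (1 - p)\<close>.\<close>
  have q: "(1 - q) * (1 - 2 * p) = 1 - p" using p by (simp add: q_def field_simps)
  have w: "?w (2 * p) = ?w 1 * ?w (2 * p - 1)"
    by (simp flip: fps_one_minus_powr_add del: fps_one_minus_powr_1)
  have w1: "?w (-1) * ?w 1 = 1" by (simp flip: fps_one_minus_powr_add del: fps_one_minus_powr_1)
  have U0: "fps_nth U 0 = 1" by (simp add: U_def)
  have UW: "U = ?w 1 * (1 - W)"
    unfolding U_def W_def w by (simp add: algebra_simps flip: fps_const_sub)
  have "fps_deriv U = - fps_const (1 - q) - fps_const (2 * p * q) * ?w (2 * p - 1)"
  proof -
    have "fps_const q * (- fps_const (2 * p) * ?w (2 * p - 1)) = - (fps_const (2 * p * q) * ?w (2 * p - 1))"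
      by (simp add: mult.assoc[symmetric] mult.commute[of q] flip: fps_const_neg)
    then show ?thesis by (simp add: U_def fps_deriv_one_minus_powr)
  qed
  also have "\<dots> = - (fps_const (2 * p) * (?w (-1) * U)) - fps_const (1 - p)"
  proof -
    have "?w (-1) * U = 1 - W" unfolding UW by (metis mult.assoc mult_1 w1)
    moreover have c: "- fps_const (1 - q) = - fps_const (2 * p) + fps_const (2 * p * q) - fps_const (1 - p)"
      using q by (simp add: algebra_simps)
    moreover have "fps_const (2 * p) * (1 - W) = fps_const (2 * p) - (fps_const (2 * p * q) - fps_const (2 * p * q) * ?w (2 * p - 1))"
      by (simp add: W_def right_diff_distrib mult.assoc[symmetric])
    ultimately show ?thesis by (simp only: c) simp
  qed
  finally have dU: "fps_deriv U = - (fps_const (2 * p) * inverse (1 - fps_X) * U) - fps_const (1 - p)"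
    unfolding inverse_one_minus_fps_X mult.assoc .
  have "expected_paths p n = fps_nth (inverse U) m"
    unfolding m_def using p U0 by (intro expected_paths_eq_fps_nth inverse_fps_riccati[OF U0 dU]) auto
  also have "inverse U = ?w (-1) * inverse (1 - W)"
    unfolding UW by (simp add: fps_inverse_mult inverse_one_minus_fps_X)
  also have "fps_nth \<dots> m = (\<Sum>k=0..m. fps_nth (?w (-1) * W ^ k) m)"
    by (rule inverse_one_minus_fps_nth) (simp add: W_def)
  also have "\<dots> = (\<Sum>k=0..m. \<Sum>j=0..m. (-1) ^ (m + j) * (((2 * p - 1) * real j - 1) gchoose m) * (real (k choose j) * q ^ k))"
  proof (intro sum.cong refl)
    fix k assume k: "k \<in> {0..m}"
    have "W ^ k = fps_const (q ^ k) * (- ?w (2 * p - 1) + 1) ^ k"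
      by (simp add: W_def power_mult_distrib)
    also have "(- ?w (2 * p - 1) + 1) ^ k = (\<Sum>j\<le>k. of_nat (k choose j) * (- ?w (2 * p - 1)) ^ j * 1 ^ (k - j))"
      by (rule binomial_ring)
    finally have "?w (-1) * W ^ k = (\<Sum>j\<le>k. fps_const (q ^ k * real (k choose j) * (-1) ^ j) * ?w (real j * (2 * p - 1) + (- 1)))"
    proof -
      have "(- ?w (2 * p - 1)) ^ j = fps_const ((-1) ^ j) * ?w (real j * (2 * p - 1))" for j
      proof -
        have "- ?w (2 * p - 1) = fps_const (-1) * ?w (2 * p - 1)" by (simp flip: fps_const_neg)
        then show ?thesis by (simp only: power_mult_distrib fps_const_power fps_one_minus_powr_power)
      qed
      moreover have "(of_nat (k choose j) :: real fps) = fps_const (real (k choose j))" for j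
        by (rule fps_of_nat[symmetric])
      moreover assume "W ^ k = fps_const (q ^ k) * (\<Sum>j\<le>k. of_nat (k choose j) * (- ?w (2 * p - 1)) ^ j * 1 ^ (k - j))"
      ultimately show ?thesis
        by (simp only: sum_distrib_left fps_one_minus_powr_add power_one mult_1_left mult_1_right fps_const_mult[symmetric] mult_ac)
    qed
    then have "fps_nth (?w (-1) * W ^ k) m =
        fps_nth (\<Sum>j\<le>k. fps_const (q ^ k * real (k choose j) * (-1) ^ j) * ?w (real j * (2 * p - 1) + (- 1))) m"
      by (rule arg_cong)
    also have "\<dots> = (\<Sum>j\<le>k. (-1) ^ (m + j) * (((2 * p - 1) * real j - 1) gchoose m) * (real (k choose j) * q ^ k))"
      by (simp add: fps_sum_nth power_add mult_ac)
    \<comment> \<open>For \<open>j > k\<close> the binomial coefficient vanishes; a range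
      independent of \<open>k\<close> allows the two sums to be exchanged.\<close>
    also have "\<dots> = (\<Sum>j=0..m. (-1) ^ (m + j) * (((2 * p - 1) * real j - 1) gchoose m) * (real (k choose j) * q ^ k))"
      using k by (intro sum.mono_neutral_left) auto
    finally show "fps_nth (?w (-1) * W ^ k) m = \<dots>" .
  qed
  also have "\<dots> = (\<Sum>j=0..m. (-1) ^ (m + j) * (((2 * p - 1) * real j - 1) gchoose m) * (\<Sum>k=0..m. real (k choose j) * q ^ k))"
    by (subst sum.swap) (simp add: sum_distrib_left)
  finally show ?thesis using n by (simp add: m_def q_def)
qed

section \<open>The exact formula for \<open>p = 1/2\<close>\<close>

text \<open>The equation expresses coefficient \<open>m + 1\<close> through the coefficients up to
  \<open>m\<close>, so the constant term determines the solution.\<close>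

lemma fps_linear_ODE_unique:
  fixes F G h :: "'a::field_char_0 fps"
  assumes "fps_deriv F = F * h" "fps_deriv G = G * h" "fps_nth F 0 = fps_nth G 0"
  shows "F = G"
proof -
  have "fps_nth F n = fps_nth G n" for n
  proof (induction n rule: less_induct)
    case (less n)
    show ?case
    proof (cases n)
      case (Suc m)
      have "of_nat (Suc m) * fps_nth F (Suc m) = fps_nth (F * h) m"
        by (simp flip: assms(1))
      also have "\<dots> = fps_nth (G * h) m"
        using less Suc by (simp add: fps_mult_nth)
      also have "\<dots> = of_nat (Suc m) * fps_nth G (Suc m)"
        by (simp flip: assms(2))
      finally show ?thesis using Suc by (simp del: of_nat_Suc)
    qed (use assms in simp)
  qed
  then show ?thesis by (simp add: fps_eq_iff)
qed

text \<open>The series of \<open>ln (1 - X)\<close>, since \<open>fps_ln 1\<close> is that of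
  \<open>ln (1 + X)\<close>.\<close>

definition fps_one_minus_ln :: "real fps" where
  "fps_one_minus_ln = fps_ln 1 oo (- fps_X)"

lemma fps_one_minus_ln_nth_0 [simp]: "fps_nth fps_one_minus_ln 0 = 0"
  by (simp add: fps_one_minus_ln_def)

lemma fps_deriv_one_minus_ln: "fps_deriv fps_one_minus_ln = - inverse (1 - fps_X)"
  by (simp add: fps_one_minus_ln_def fps_compose_deriv fps_ln_deriv fps_inverse_compose fps_compose_add_distrib)

text \<open>Formally this is the expansion in \<open>s\<close> of the coefficient of
  \<open>X ^ m\<close> in \<open>(1 - X)^(s - 1)\<close>, which is the product of the
  \<open>1 - s / j\<close>. The induction shows that both sides obey the same recursion in
  \<open>m\<close>.\<close>

lemma one_minus_ln_power_nth:
  "fps_nth (inverse (1 - fps_X) * fps_one_minus_ln ^ k) m =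
     fact k * fps_nth (\<Prod>j=1..m. 1 - fps_const (1 / real j) * fps_X) k"
proof (induction m arbitrary: k)
  case 0
  show ?case by (cases k) (auto simp: startsby_zero_power)
next
  case (Suc m)
  let ?g = "inverse (1 - fps_X) :: real fps" and ?L = fps_one_minus_ln
  let ?e = "\<Prod>j=1..m. 1 - fps_const (1 / real j) * fps_X"
  have g1: "(1 - fps_X) * ?g = 1" by (rule inverse_mult_eq_1') simp
  \<comment> \<open>Multiplication by \<open>1 / (1 - X)\<close> forms partial sums, so passing from
    \<open>m\<close> to \<open>m + 1\<close> adds one coefficient of \<open>?L ^ k\<close>.\<close>
  have "?g = 1 + fps_X * ?g" using g1 by (simp add: algebra_simps)
  then have "?g * ?L ^ k = (1 + fps_X * ?g) * ?L ^ k" by (rule arg_cong)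
  then have *: "?g * ?L ^ k = ?L ^ k + fps_X * (?g * ?L ^ k)"
    unfolding distrib_right mult.assoc mult_1 .
  have step: "fps_nth (?g * ?L ^ k) (Suc m) = fps_nth (?L ^ k) (Suc m) + fps_nth (?g * ?L ^ k) m"
    by (subst *) simp
  have e: "(\<Prod>j=1..Suc m. 1 - fps_const (1 / real j) * fps_X) = ?e - fps_const (1 / real (Suc m)) * (fps_X * ?e)"
    by (simp add: right_diff_distrib left_diff_distrib mult_ac)
  show ?case
  proof (cases k)
    case 0
    then show ?thesis using step Suc.IH[of 0] unfolding e by simp
  next
    case k: (Suc k')
    \<comment> \<open>That coefficient is read off from the derivative
      \<open>- k L^(k-1) / (1 - X)\<close>, to which the induction hypothesis for
      \<open>k - 1\<close> applies.\<close>
    have "real (Suc m) * fps_nth (?L ^ k) (Suc m) = fps_nth (fps_deriv (?L ^ Suc k')) m"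
      unfolding k fps_deriv_nth by simp
    also have "fps_deriv (?L ^ Suc k') = - (fps_const (real (Suc k')) * (?g * ?L ^ k'))"
      by (simp add: fps_deriv_power fps_deriv_one_minus_ln mult_ac del: power_Suc of_nat_Suc)
    also have "fps_nth \<dots> m = - (real (Suc k') * (fact k' * fps_nth ?e k'))"
      using Suc.IH[of k'] by simp
    finally have "fps_nth (?L ^ k) (Suc m) = - (fact k * fps_nth ?e k') / real (Suc m)"
      by (simp add: k field_simps del: of_nat_Suc)
    then show ?thesis unfolding step Suc.IH e
      by (simp add: k right_diff_distrib)
  qed
qed

text \<open>Expanding each \<open>ln (1 - X / i)\<close> shows that the exponent, with coefficients
  \<open>- H^(j) / j\<close>, is the logarithm of the product. Instead of taking logarithms, both
  sides are shown to solve the same linear differential equation.\<close>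

lemma complete_bell_gen_harm:
  "complete_bell k (\<lambda>j. - (fact (j - 1) * gen_harm j m)) =
     fact k * fps_nth (\<Prod>j=1..m. 1 - fps_const (1 / real j) * fps_X) k"
proof -
  define Y where "Y m = Abs_fps (\<lambda>j. if j = 0 then 0 else - (fact (j - 1) * gen_harm j m) / fact j)" for m
  define e :: "nat \<Rightarrow> real fps" where "e m = (\<Prod>j=1..m. 1 - fps_const (1 / real j) * fps_X)" for m
  have Y': "fps_deriv (Y m) = Abs_fps (\<lambda>j. - gen_harm (Suc j) m)" for m
    by (rule fps_ext) (simp add: Y_def field_simps del: of_nat_Suc)
  have de: "fps_deriv (e m) = e m * fps_deriv (Y m)" for m
  proof (induction m)
    case (Suc m)
    define c where "c = 1 / real (Suc m)"
    \<comment> \<open>\<open>l\<close> is the logarithmic derivative \<open>- c / (1 - c X)\<close>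
      of the new factor, written as a geometric series.\<close>
    define l where "l = Abs_fps (\<lambda>j. - (c ^ Suc j))"
    have l: "l * (1 - fps_const c * fps_X) = - fps_const c"
    proof (rule fps_ext)
      fix j show "fps_nth (l * (1 - fps_const c * fps_X)) j = fps_nth (- fps_const c) j"
        by (cases j) (simp_all add: l_def right_diff_distrib mult.assoc[symmetric])
    qed
    have "fps_deriv (Y (Suc m)) = fps_deriv (Y m) + l"
      unfolding Y' by (rule fps_ext) (simp add: l_def gen_harm_def c_def power_divide del: of_nat_Suc)
    moreover have eS: "e (Suc m) = e m * (1 - fps_const c * fps_X)"
      by (simp add: e_def c_def)
    ultimately have "e (Suc m) * fps_deriv (Y (Suc m)) = e m * fps_deriv (Y m) * (1 - fps_const c * fps_X) + e m * (l * (1 - fps_const c * fps_X))"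
      by (simp only: distrib_left distrib_right mult_ac)
    also have "\<dots> = fps_deriv (e (Suc m))"
      unfolding l Suc.IH[symmetric] eS by (simp add: algebra_simps del: fps_const_neg)
    finally show ?case ..
  qed (simp add: e_def Y' gen_harm_def fps_eq_iff)
  have "fps_exp 1 oo Y m = e m"
  proof (rule fps_linear_ODE_unique)
    show "fps_deriv (fps_exp 1 oo Y m) = (fps_exp 1 oo Y m) * fps_deriv (Y m)"
      by (simp add: fps_compose_deriv Y_def)
    show "fps_nth (fps_exp 1 oo Y m) 0 = fps_nth (e m) 0"
      by (simp add: e_def fps_prod_nth')
  qed (rule de)
  then show ?thesis by (simp only: complete_bell_def Y_def[symmetric] e_def[symmetric])
qed

text \<open>At \<open>p = 1/2\<close> the exponents 1 and \<open>2 p\<close> coincide, and the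
  linear equation has the solution \<open>U = (1 - X)(1 + ln (1 - X) / 2)\<close>. Its inverse is
  expanded geometrically as before, now in powers of the logarithm.\<close>

lemma expected_paths_exact_half:
  "expected_paths (1/2) n = (\<Sum>k=0..n-1. (-1) ^ k / 2 ^ k *
              complete_bell k (\<lambda>j. - (fact (j - 1) * gen_harm j (n - 1))))"
proof -
  define m where "m = n - 1"
  define W where "W = - (fps_const (1/2) * fps_one_minus_ln)"
  define U where "U = (1 - fps_X) * (1 - W)"
  have U0: "fps_nth U 0 = 1" by (simp add: U_def W_def)
  have g1: "inverse (1 - fps_X) * (1 - fps_X) = (1 :: real fps)" by (rule inverse_mult_eq_1) simp
  have gU: "inverse (1 - fps_X) * U = 1 - W"
    unfolding U_def by (metis g1 mult.assoc mult_1)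
  have "fps_deriv U = - (1 - W) - fps_const (1/2) * (inverse (1 - fps_X) * (1 - fps_X))"
    by (simp add: U_def W_def fps_deriv_one_minus_ln algebra_simps)
  then have dU: "fps_deriv U = - (fps_const (2 * (1/2)) * inverse (1 - fps_X) * U) - fps_const (1 - 1/2)"
    unfolding g1 by (simp add: mult.assoc gU)
  have "expected_paths (1/2) n = fps_nth (inverse U) m"
    unfolding m_def using U0 by (intro expected_paths_eq_fps_nth inverse_fps_riccati[OF U0 dU]) auto
  also have "inverse U = inverse (1 - fps_X) * inverse (1 - W)"
    by (simp add: U_def fps_inverse_mult)
  also have "fps_nth \<dots> m = (\<Sum>k=0..m. fps_nth (inverse (1 - fps_X) * W ^ k) m)"
    by (rule inverse_one_minus_fps_nth) (simp add: W_def)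
  also have "\<dots> = (\<Sum>k=0..m. (-1) ^ k / 2 ^ k * fps_nth (inverse (1 - fps_X) * fps_one_minus_ln ^ k) m)"
  proof (intro sum.cong refl)
    fix k
    have "W = fps_const (-(1/2)) * fps_one_minus_ln" by (simp add: W_def flip: fps_const_neg)
    then have "inverse (1 - fps_X) * W ^ k = fps_const ((-(1/2)) ^ k) * (inverse (1 - fps_X) * fps_one_minus_ln ^ k)"
      by (simp add: power_mult_distrib fps_const_power mult_ac)
    moreover have "(-(1/2)) ^ k = (-1) ^ k / (2::real) ^ k" by (simp add: power_minus[of "1/2"] power_one_over)
    ultimately have "fps_nth (inverse (1 - fps_X) * W ^ k) m =
        fps_nth (fps_const ((-1) ^ k / 2 ^ k) * (inverse (1 - fps_X) * fps_one_minus_ln ^ k)) m"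
      by (simp only:)
    then show "fps_nth (inverse (1 - fps_X) * W ^ k) m = (-1) ^ k / 2 ^ k * fps_nth (inverse (1 - fps_X) * fps_one_minus_ln ^ k) m"
      by (simp only: fps_mult_left_const_nth)
  qed
  finally show ?thesis by (simp only: one_minus_ln_power_nth complete_bell_gen_harm m_def)
qed

section \<open>From real to complex coefficients\<close>

text \<open>All coefficients of \<open>1 / (1 - X)\<close> are 1. The recursion is stated over a
  general field since it is applied to both the real and the complex series.\<close>

lemma riccati_rhs_nth:
  fixes G :: "'a::field_char_0 fps"
  shows "fps_nth (fps_const a * G * inverse (1 - fps_X) + fps_const b * G ^ 2) n =
    a * (\<Sum>i=0..n. fps_nth G i) + b * (\<Sum>i=0..n. fps_nth G i * fps_nth G (n - i))"
proof -
  have inv: "fps_nth (inverse (1 - fps_X :: 'a fps)) i = 1" for i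
    by (simp add: inverse_one_minus_fps_X gbinomial_minus[of 1, simplified] binomial_gbinomial[symmetric] flip: power_mult_distrib)
  show ?thesis
    unfolding mult.assoc fps_add_nth fps_mult_left_const_nth
    by (simp add: fps_mult_nth inv power2_eq_square)
qed

text \<open>The recursion has real coefficients and a real starting value, so the complex solution
  has real coefficients, and its real part solves the real equation.\<close>

lemma expected_paths_eq_complex_fps_nth:
  fixes F :: "complex fps"
  assumes p: "0 < p" "p < 1" and F0: "fps_nth F 0 = 1"
    and F: "fps_deriv F = fps_const (of_real (2 * p)) * F * inverse (1 - fps_X) + fps_const (of_real (1 - p)) * F ^ 2"
  shows "fps_nth F (n - 1) = of_real (expected_paths p n)"
proof -
  have real: "fps_nth F m \<in> \<real>" for m
  proof (induction m rule: less_induct)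
    case (less m)
    show ?case
    proof (cases m)
      case (Suc n)
      have "of_nat (Suc n) * fps_nth F (Suc n) = fps_nth (fps_deriv F) n" by simp
      also have "\<dots> \<in> \<real>"
        unfolding F riccati_rhs_nth using less Suc

        by (intro Reals_add Reals_mult sum_in_Reals) auto
      finally have "of_nat (Suc n) * fps_nth F (Suc n) / of_nat (Suc n) \<in> \<real>"
        by (intro Reals_divide) auto
      then show ?thesis using Suc by (simp del: of_nat_Suc)
    qed (use F0 in simp)
  qed
  define f where "f = Abs_fps (\<lambda>m. Re (fps_nth F m))"
  have *: "of_real (fps_nth f m) = fps_nth F m" for m
    using real by (simp add: f_def)
  have f0: "fps_nth f 0 = 1" using F0 by (simp add: f_def)
  have f: "fps_deriv f = fps_const (2 * p) * f * inverse (1 - fps_X) + fps_const (1 - p) * f ^ 2"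
  proof (rule fps_ext)
    fix n
    have "(of_real (fps_nth (fps_deriv f) n) :: complex) = fps_nth (fps_deriv F) n"
      by (simp add: *)
    also have "\<dots> = of_real (fps_nth (fps_const (2 * p) * f * inverse (1 - fps_X) + fps_const (1 - p) * f ^ 2) n)"
      unfolding F riccati_rhs_nth by (simp add: *)
    finally show "fps_nth (fps_deriv f) n = fps_nth (fps_const (2 * p) * f * inverse (1 - fps_X) + fps_const (1 - p) * f ^ 2) n"
      by (simp only: of_real_eq_iff)
  qed
  then show ?thesis
    using expected_paths_eq_fps_nth[OF _ _ f0 f, of n] p by (simp flip: *)
qed

subsection \<open>Transfer of bounds to Taylor coefficients\<close>

text \<open>On the circle \<open>cnj z = r^2 / z\<close>, hence
  \<open>1 / |1 - z|^2 = z / ((1 - z)(z - r^2))\<close>, and Cauchy's formula for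
  \<open>1 / (1 - u)\<close> at the point \<open>r^2\<close> evaluates the mean.\<close>

lemma has_integral_inverse_norm_one_minus_circlepath:
  assumes r: "0 < r" "r < 1"
  shows "((\<lambda>t. 1 / norm (1 - circlepath 0 r t) ^ 2) has_integral 1 / (1 - r ^ 2)) {0..1}"
proof -
  let ?g = "circlepath 0 r"
  have "((\<lambda>u. (1 / (1 - u)) / (u - of_real (r ^ 2)) ^ Suc 0) has_contour_integral
      (2 * pi * \<i>) / fact 0 * (deriv ^^ 0) (\<lambda>u. 1 / (1 - u)) (of_real (r ^ 2))) ?g"
  proof (rule Cauchy_has_contour_integral_higher_derivative_circlepath)
    show "continuous_on (cball 0 r) (\<lambda>u::complex. 1 / (1 - u))"
      using r by (auto intro!: continuous_intros)
    show "(\<lambda>u::complex. 1 / (1 - u)) holomorphic_on ball 0 r"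
      using r by (auto intro!: holomorphic_intros)
    show "complex_of_real (r ^ 2) \<in> ball 0 r"
      using r by (simp add: norm_power power2_eq_square norm_mult)
  qed
  then have "((\<lambda>t. 1 / (1 - ?g t) / (?g t - of_real (r ^ 2)) * vector_derivative ?g (at t)) has_integral
      2 * pi * \<i> / (1 - of_real (r ^ 2))) {0..1}"
    by (simp add: has_contour_integral)
  also have "(\<lambda>t. 1 / (1 - ?g t) / (?g t - of_real (r ^ 2)) * vector_derivative ?g (at t)) =
      (\<lambda>t. 2 * pi * \<i> * of_real (1 / norm (1 - ?g t) ^ 2))"
  proof
    fix t
    have n: "norm (?g t) = r" using r by (simp add: circlepath norm_mult)
    have z: "?g t \<noteq> 0" "1 - ?g t \<noteq> 0" using n r by auto
    have "vector_derivative ?g (at t) = 2 * pi * \<i> * ?g t"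
      by (subst vector_derivative_circlepath) (simp add: circlepath)
    moreover have "of_real (r ^ 2) = ?g t * cnj (?g t)"
      using n complex_norm_square[of "?g t"] by simp
    then have "?g t - of_real (r ^ 2) = ?g t * cnj (1 - ?g t)"
      by (simp add: algebra_simps)
    moreover have "of_real (norm (1 - ?g t) ^ 2) = (1 - ?g t) * cnj (1 - ?g t)"
      using complex_norm_square[of "1 - ?g t"] by simp
    ultimately show "1 / (1 - ?g t) / (?g t - of_real (r ^ 2)) * vector_derivative ?g (at t) =
      2 * pi * \<i> * of_real (1 / norm (1 - ?g t) ^ 2)"
      using z by (simp add: divide_simps)
  qed
  also have "2 * pi * \<i> / (1 - of_real (r ^ 2)) = 2 * pi * \<i> * of_real (1 / (1 - r ^ 2))"
    by simp
  finally have "((\<lambda>t. complex_of_real (1 / norm (1 - ?g t) ^ 2)) has_integral of_real (1 / (1 - r ^ 2))) {0..1}"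
    by (subst (asm) has_integral_mult_right_iff) auto
  then have "((\<lambda>t. Re (complex_of_real (1 / norm (1 - ?g t) ^ 2))) has_integral Re (of_real (1 / (1 - r ^ 2)))) {0..1}"
    by (rule has_integral_Re)
  then show ?thesis by simp
qed

text \<open>Cauchy's coefficient formula with the mean of \<open>1 / |1 - z|^2\<close> evaluated
  exactly: this costs only \<open>1 / (1 - r^2)\<close>, where the maximum over the circle would
  cost \<open>1 / (1 - r)^2\<close>.\<close>

lemma norm_taylor_coeff_le:
  assumes r: "0 < r" "r < 1" and hol: "H holomorphic_on ball 0 1"
    and bd: "\<And>z. norm z = r \<Longrightarrow> norm (H z) \<le> K / norm (1 - z) ^ 2"
  shows "norm ((deriv ^^ k) H 0) \<le> fact k * (K / (r ^ k * (1 - r ^ 2)))"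
proof -
  let ?g = "circlepath 0 r"
  define F where "F t = H (?g t) / ?g t ^ Suc k * vector_derivative ?g (at t)" for t
  have "((\<lambda>u. H u / (u - 0) ^ Suc k) has_contour_integral (2 * pi * \<i>) / fact k * (deriv ^^ k) H 0) ?g"
    using r by (intro Cauchy_has_contour_integral_higher_derivative_circlepath
      holomorphic_on_imp_continuous_on holomorphic_on_subset[OF hol]) auto
  then have F: "(F has_integral (2 * pi * \<i>) / fact k * (deriv ^^ k) H 0) {0..1}"
    by (simp add: has_contour_integral F_def[abs_def])
  have G: "((\<lambda>t. 2 * pi * K / r ^ k * (1 / norm (1 - ?g t) ^ 2)) has_integral
      2 * pi * K / r ^ k * (1 / (1 - r ^ 2))) {0..1}"
    by (intro has_integral_mult_right has_integral_inverse_norm_one_minus_circlepath r)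
  have "norm (F t) \<le> 2 * pi * K / r ^ k * (1 / norm (1 - ?g t) ^ 2)" for t
  proof -
    have n: "norm (?g t) = r" using r by (simp add: circlepath norm_mult)
    have "norm (F t) = norm (H (?g t)) / r ^ Suc k * (2 * pi * r)"
      using n r by (simp add: F_def norm_mult norm_divide norm_power vector_derivative_circlepath)
    also have "\<dots> \<le> (K / norm (1 - ?g t) ^ 2) / r ^ Suc k * (2 * pi * r)"
      using r bd[OF n] by (intro mult_right_mono divide_right_mono) auto
    also have "\<dots> = 2 * pi * K / r ^ k * (1 / norm (1 - ?g t) ^ 2)"
      using r by (simp add: field_simps)
    finally show ?thesis .
  qed
  then have "norm ((2 * pi * \<i>) / fact k * (deriv ^^ k) H 0) \<le> 2 * pi * K / r ^ k * (1 / (1 - r ^ 2))"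
    using F G integral_norm_bound_integral[of F "{0..1}" "\<lambda>t. 2 * pi * K / r ^ k * (1 / norm (1 - ?g t) ^ 2)"]
    by (auto simp: has_integral_iff)
  then have "2 * pi * norm ((deriv ^^ k) H 0) \<le> 2 * pi * (fact k * (K / (r ^ k * (1 - r ^ 2))))"
    by (simp add: norm_mult norm_divide field_simps)
  then show ?thesis by (subst (asm) mult_le_cancel_left_pos) simp_all
qed

lemma powr_ratio_le:
  fixes x y \<beta> :: real
  assumes "x > 0" "y > 0" "x / 2 \<le> y" "y \<le> 2 * x"
  shows "y powr \<beta> \<le> 2 powr \<bar>\<beta>\<bar> * x powr \<beta>"
proof -
  have "\<bar>ln (y / x)\<bar> \<le> ln 2"
  proof -
    have "ln (y / x) \<le> ln 2" using assms by (subst ln_le_cancel_iff) (auto simp: field_simps)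
    moreover have "ln (1/2) \<le> ln (y / x)" using assms by (subst ln_le_cancel_iff) (auto simp: field_simps)
    ultimately show ?thesis by (simp add: ln_div)
  qed
  then have "\<bar>\<beta>\<bar> * \<bar>ln (y / x)\<bar> \<le> \<bar>\<beta>\<bar> * ln 2" by (intro mult_left_mono) auto
  then have "\<beta> * ln (y / x) \<le> \<bar>\<beta>\<bar> * ln 2" by (simp flip: abs_mult)
  then have "(y / x) powr \<beta> \<le> 2 powr \<bar>\<beta>\<bar>"
    using assms by (simp add: powr_def)
  then show ?thesis using assms by (simp add: powr_divide field_simps)
qed

text \<open>
  A disc of radius \<open>\<bar>1 - z\<bar> / 4\<close> around a point of the unit disc stays in the sector, so Cauchy's
  inequality bounds the third derivative of \<open>h\<close>; after three differentiations
  the mean value of \<open>\<bar>1 - z\<bar>\<^sup>-\<^sup>2\<close> over a circle of radius \<open>1 - 1 / n\<close> suffices.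
\<close>
lemma transfer_coeff_bound:
  fixes h :: "complex \<Rightarrow> complex" and \<beta> M :: real and n :: nat
  assumes hol: "h holomorphic_on {w. 1 - w \<notin> \<real>\<^sub>\<le>\<^sub>0}"
    and M: "M \<ge> 0" and \<beta>: "\<beta> \<ge> -1" and n: "n \<ge> 4"
    and bd: "\<And>w. - norm (1 - w) / 3 \<le> Re (1 - w) \<Longrightarrow> 1 / (2 * real n) \<le> norm (1 - w) \<Longrightarrow>
        norm (1 - w) \<le> 3 \<Longrightarrow> norm (h w) \<le> M * norm (1 - w) powr (- \<beta>)"
  shows "norm ((deriv ^^ (n - 1)) h 0 / fact (n - 1)) \<le>
    (384 * 11 * exp 2 * 2 powr \<bar>\<beta>\<bar>) * M * real n powr (\<beta> - 1)"
proof -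
  define D where "D = {w::complex. 1 - w \<notin> \<real>\<^sub>\<le>\<^sub>0}"
  define r where "r = 1 - 1 / real n"
  \<comment> \<open>\<open>384 = 3! * 4^3\<close> comes from Cauchy's inequality for the third
    derivative on a disc of radius \<open>v / 4\<close>.\<close>
  define K where "K = 384 * 2 powr \<bar>\<beta>\<bar> * M * real n powr (\<beta> + 1)"
  \<comment> \<open>Of the \<open>n - 1\<close> derivatives three are spent on the pointwise bound;
    \<open>n - 4\<close> remain for the integral over the circle.\<close>
  define k where "k = n - 4"
  have r: "0 < r" "r < 1" using n by (auto simp: r_def field_simps)
  have "D = (\<lambda>w. 1 - w) -` (- \<real>\<^sub>\<le>\<^sub>0)" by (auto simp: D_def)
  then have opD: "open D"
    by (auto intro!: continuous_open_vimage continuous_intros simp: open_Compl)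
  have H_hol: "(deriv ^^ 3) h holomorphic_on D"
    using hol by (intro holomorphic_higher_deriv opD) (simp add: D_def)
  have "ball 0 1 \<subseteq> D"
  proof
    fix w :: complex assume "w \<in> ball 0 1"
    then have "Re (1 - w) > 0" using complex_Re_le_cmod[of w] by simp
    then show "w \<in> D" by (auto simp: D_def complex_nonpos_Reals_iff)
  qed
  then have H_hol1: "(deriv ^^ 3) h holomorphic_on ball 0 1" by (rule holomorphic_on_subset[OF H_hol])
  have H_bd: "norm ((deriv ^^ 3) h z) \<le> K / norm (1 - z) ^ 2" if z: "norm z = r" for z
  proof -
    define v where "v = norm (1 - z)"
    have "0 < 1 / real n" using n by simp
    then have v: "1 / real n \<le> v" "v < 2" "Re (1 - z) > 0"
      using norm_triangle_ineq2[of 1 z] norm_triangle_ineq4[of 1 z] z r complex_Re_le_cmod[of z]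
      unfolding v_def r_def by (simp_all del: zero_less_divide_1_iff)
    have v0: "v > 0" using v \<open>0 < 1 / real n\<close> by linarith
    \<comment> \<open>These inequalities place the disc in the region of the hypothesis:
      \<open>- v / 4\<close> is at least \<open>- |1 - x| / 3\<close>, \<open>3 v / 4\<close> is at
      least \<open>1 / (2 n)\<close>, and \<open>5 v / 4 < 3\<close>.\<close>
    have ball: "3 / 4 * v \<le> norm (1 - x)" "norm (1 - x) \<le> 5 / 4 * v" "- v / 4 \<le> Re (1 - x)"
      if "norm (z - x) \<le> v / 4" for x
      using that norm_triangle_ineq2[of "1 - z" "x - z"] norm_triangle_ineq[of "1 - z" "z - x"]
        complex_Re_le_cmod[of "x - z"] v(3) by (auto simp: v_def norm_minus_commute)
    have sub: "cball z (v / 4) \<subseteq> D"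
    proof
      fix x assume "x \<in> cball z (v / 4)"
      then have x: "norm (z - x) \<le> v / 4" by (simp add: dist_norm)
      show "x \<in> D"
      proof (rule ccontr)
        assume "x \<notin> D"
        then have "1 - x \<in> \<real>\<^sub>\<le>\<^sub>0" by (simp add: D_def)
        then have "norm (1 - x) = - Re (1 - x)"
          by (auto simp: complex_nonpos_Reals_iff cmod_def)
        with ball[OF x] v0 show False by linarith
      qed
    qed
    have "norm ((deriv ^^ 3) h z) \<le> fact 3 * (M * (2 powr \<bar>- \<beta>\<bar> * v powr (- \<beta>))) / (v / 4) ^ 3"
    proof (rule Cauchy_inequality)
      show "h holomorphic_on ball z (v / 4)" "continuous_on (cball z (v / 4)) h"
        using hol sub unfolding D_def[symmetric]
        by (meson ball_subset_cball holomorphic_on_imp_continuous_on holomorphic_on_subset)+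
      fix x assume "norm (z - x) = v / 4"
      then have x: "norm (z - x) \<le> v / 4" by simp
      have "norm (h x) \<le> M * norm (1 - x) powr (- \<beta>)"
      proof (rule bd)
        have "1 / (2 * real n) = (1 / real n) / 2" by simp
        then show "1 / (2 * real n) \<le> norm (1 - x)" using ball[OF x] v v0 by linarith
      qed (use ball[OF x] v v0 in linarith)+
      also have "norm (1 - x) powr (- \<beta>) \<le> 2 powr \<bar>- \<beta>\<bar> * v powr (- \<beta>)"
        using ball[OF x] v0 by (intro powr_ratio_le) auto
      finally show "norm (h x) \<le> M * (2 powr \<bar>- \<beta>\<bar> * v powr (- \<beta>))"
        using M by (simp add: mult_left_mono)
    qed (use v0 in simp)
    also have "\<dots> = 384 * 2 powr \<bar>\<beta>\<bar> * M * v powr (- (\<beta> + 1)) / v ^ 2"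
    proof -
      have "v powr (- \<beta>) = v powr (- (\<beta> + 1)) * v" using v0 by (simp add: powr_diff powr_minus field_simps)
      then show ?thesis using v0 by (simp add: fact_numeral field_simps power2_eq_square power3_eq_cube)
    qed
    also have "\<dots> \<le> 384 * 2 powr \<bar>\<beta>\<bar> * M * real n powr (\<beta> + 1) / v ^ 2"
    proof -
      \<comment> \<open>The exponent is nonpositive since \<open>\<beta> \<ge> -1\<close>, so the
        power is largest at the smallest distance \<open>1 / n\<close>.\<close>
      have "v powr (- (\<beta> + 1)) \<le> (1 / real n) powr (- (\<beta> + 1))"
        using \<beta> v n by (intro powr_mono2') auto
      also have "\<dots> = real n powr (\<beta> + 1)" using n by (simp add: powr_divide add.commute flip: powr_minus_divide)
      finally show ?thesis using M by (intro divide_right_mono mult_left_mono) auto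
    qed
    finally show ?thesis by (simp add: K_def v_def)
  qed
  have K0: "K \<ge> 0" using M by (simp add: K_def)
  have "norm ((deriv ^^ k) ((deriv ^^ 3) h) 0) \<le> fact k * (K / (r ^ k * (1 - r ^ 2)))"
    by (rule norm_taylor_coeff_le[OF r H_hol1 H_bd])
  also have "\<dots> \<le> fact k * (K * exp 2 * real n)"
  proof -
    \<comment> \<open>With \<open>r = 1 - 1 / n\<close> the power \<open>r ^ k\<close> stays above
      \<open>exp (- 2)\<close>, because \<open>k \<le> n\<close> and
      \<open>ln r \<ge> - 2 / n\<close>.\<close>
    have "ln (1 - 1 / real n) \<ge> - (1 / real n) - 2 * (1 / real n) ^ 2"
      using n by (intro ln_one_minus_pos_lower_bound) (auto simp: field_simps)
    also have "- (1 / real n) - 2 * (1 / real n) ^ 2 \<ge> - (2 / real n)"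
      using n by (simp add: field_simps power2_eq_square)
    finally have "real k * ln r \<ge> real k * (- (2 / real n))"
      unfolding r_def by (intro mult_left_mono) auto
    also have "real k * (- (2 / real n)) \<ge> - 2" using n by (simp add: k_def field_simps)
    finally have "exp (- 2) \<le> exp (real k * ln r)" by simp
    also have "\<dots> = r ^ k" using r by (simp add: exp_of_nat_mult)
    finally have rk: "exp (- 2) \<le> r ^ k" .
    have "r ^ 2 \<le> r" using r by (simp add: power2_eq_square mult_left_le_one_le)
    then have "1 / real n \<le> 1 - r ^ 2" by (simp add: r_def)
    then have "exp (- 2) * (1 / real n) \<le> r ^ k * (1 - r ^ 2)"
      using rk n r by (intro mult_mono) auto
    then have "K / (r ^ k * (1 - r ^ 2)) \<le> K / (exp (- 2) * (1 / real n))"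
    proof (intro divide_left_mono K0)
      have "0 < exp (- 2) * (1 / real n)" using n by simp
      then show "0 < r ^ k * (1 - r ^ 2) * (exp (- 2) * (1 / real n))"
        using \<open>exp (- 2) * (1 / real n) \<le> r ^ k * (1 - r ^ 2)\<close> by (metis less_le_trans mult_pos_pos)
    qed
    also have "\<dots> = K * exp 2 * real n" by (simp add: exp_minus field_simps)
    finally show ?thesis by (intro mult_left_mono) auto
  qed
  finally have *: "norm ((deriv ^^ k) ((deriv ^^ 3) h) 0) \<le> fact k * (K * exp 2 * real n)" .
  have "(deriv ^^ (n - 1)) h = (deriv ^^ k) ((deriv ^^ 3) h)"
    using n by (simp add: k_def flip: funpow_add[THEN fun_cong, unfolded o_def])
  then have "norm ((deriv ^^ (n - 1)) h 0 / fact (n - 1)) \<le> fact k * (K * exp 2 * real n) / fact (n - 1)"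
    using * by (simp add: norm_divide divide_right_mono)
  also have "fact (n - 1) = fact k * (real (n - 1) * real (n - 2) * real (n - 3))"
  proof -
    have "n - 1 = Suc (Suc (Suc k))" using n by (simp add: k_def)
    moreover have "n - 2 = Suc (Suc k)" "n - 3 = Suc k" using n by (auto simp: k_def)
    ultimately show ?thesis by (simp add: algebra_simps)
  qed
  also have "fact k * (K * exp 2 * real n) / (fact k * (real (n - 1) * real (n - 2) * real (n - 3))) =
      K * exp 2 * real n / (real (n - 1) * real (n - 2) * real (n - 3))"
    by simp
  also have "\<dots> \<le> K * exp 2 * real n / (real n ^ 3 / 11)"
  proof -
    define Q where "Q = real (n - 1) * real (n - 2) * real (n - 3)"
    \<comment> \<open>The three factors are bounded below separately using \<open>n \<ge> 4\<close>;
      since \<open>3 / 32 \<ge> 1 / 11\<close>, the constant 11 results.\<close>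
    have "(3 / 4 * real n) * (real n / 2) * (real n / 4) \<le> Q"
      unfolding Q_def using n by (intro mult_mono mult_nonneg_nonneg) (auto simp: field_simps)
    moreover have "(3 / 4 * real n) * (real n / 2) * (real n / 4) = 3 / 32 * real n ^ 3"
      by (simp add: power3_eq_cube)
    moreover have "0 \<le> Q" by (simp add: Q_def)
    ultimately have "real n ^ 3 / 11 \<le> real (n - 1) * real (n - 2) * real (n - 3)"
      unfolding Q_def[symmetric] by linarith
    then show ?thesis using K0 n by (intro divide_left_mono mult_pos_pos) (auto intro!: mult_nonneg_nonneg)
  qed
  also have "\<dots> = (384 * 11 * exp 2 * 2 powr \<bar>\<beta>\<bar>) * M * (real n powr (\<beta> + 1) / real n ^ 2)"
    using n by (simp add: K_def field_simps power2_eq_square power3_eq_cube)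
  also have "real n powr (\<beta> + 1) / real n ^ 2 = real n powr (\<beta> - 1)"
    using n powr_diff[of "real n" "\<beta> + 1" 2] by simp
  finally show ?thesis .
qed

subsection \<open>The generating function\<close>

text \<open>
  The reciprocal of the generating function \<open>\<Sum>m. expected_paths p (m + 1) * z ^ m\<close>,
  in terms of \<open>v = 1 - z\<close>.
\<close>
definition recip_gf :: "real \<Rightarrow> complex \<Rightarrow> complex" where
  "recip_gf p v = (if p = 1/2 then v * (1 + Ln v / 2)
     else of_real ((1 - p) / (1 - 2 * p)) * v + of_real (p / (2 * p - 1)) * v powr of_real (2 * p))"

text \<open>For \<open>0 < p < 1\<close> this is the only zero of \<open>recip_gf p\<close> on the
  slit plane, by \<open>recip_gf_eq_0_iff\<close>; the corresponding pole in \<open>z\<close> is at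
  \<open>1 - gf_root p\<close>.\<close>

definition gf_root :: "real \<Rightarrow> real" where
  "gf_root p = (if p = 1/2 then exp (-2) else (p / (1 - p)) powr (1 / (1 - 2 * p)))"

lemma growth_rate_eq: "growth_rate p = 1 / (1 - gf_root p)"
  by (simp add: growth_rate_def gf_root_def inverse_eq_divide)

lemma open_slit: "open (- \<real>\<^sub>\<le>\<^sub>0 :: complex set)"
  by (simp add: open_Compl)

lemma recip_gf_1 [simp]: "recip_gf p 1 = 1"
proof (cases "p = 1/2")
  case True
  show ?thesis unfolding True by (simp add: recip_gf_def)
next
  case False
  then have "(1 - p) / (1 - 2 * p) + p / (2 * p - 1) = 1" by (simp add: divide_simps) (simp add: algebra_simps)
  then have "complex_of_real ((1 - p) / (1 - 2 * p)) + complex_of_real (p / (2 * p - 1)) = 1"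
    by (simp only: of_real_add[symmetric] of_real_1)
  then show ?thesis using False
    by (simp add: recip_gf_def del: of_real_divide of_real_diff)
qed

lemma recip_gf_factor:
  assumes "v \<noteq> 0" "p \<noteq> 1/2"
  shows "recip_gf p v = v * (of_real ((1 - p) / (1 - 2 * p)) + of_real (p / (2 * p - 1)) * v powr of_real (2 * p - 1))"
proof -
  have "v powr of_real (2 * p) = v powr of_real (2 * p - 1) * v powr 1"
    unfolding powr_add[symmetric] by simp
  then show ?thesis using assms by (simp add: recip_gf_def algebra_simps)
qed

text \<open>The linear equation for \<open>U\<close> in the variable \<open>v = 1 - z\<close>, with
  signs reversed since \<open>d/dz = - d/dv\<close>. One form covers both cases of \<open>p\<close>;
  it yields holomorphy, the derivative at the zero and the link to the formal equation.\<close>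

lemma recip_gf_deriv:
  assumes v: "v \<in> - \<real>\<^sub>\<le>\<^sub>0"
  shows "(recip_gf p has_field_derivative (of_real (2 * p) * recip_gf p v / v + of_real (1 - p))) (at v)"
proof -
  have v0: "v \<noteq> 0" using v by auto
  show ?thesis
  proof (cases "p = 1/2")
    case True
    have "((\<lambda>v. v * (1 + Ln v / 2)) has_field_derivative (1 + Ln v / 2) + 1 / 2) (at v)"
      using v v0 by (auto intro!: derivative_eq_intros)
    then show ?thesis unfolding True using v0 by (simp add: recip_gf_def[abs_def])
  next
    case False
    define A where "A = (1 - p) / (1 - 2 * p)"
    define B where "B = p / (2 * p - 1)"
    have A: "2 * p * A + (1 - p) = A" using False by (simp add: A_def divide_simps) (simp add: algebra_simps)
    have "((\<lambda>v. of_real A * v + of_real B * v powr of_real (2 * p)) has_field_derivative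
        of_real A + of_real B * (of_real (2 * p) * v powr (of_real (2 * p) - 1))) (at v)"
      using v by (auto intro!: derivative_eq_intros has_field_derivative_powr)
    moreover have "of_real (2 * p) * (of_real A * v + of_real B * v powr of_real (2 * p)) / v + of_real (1 - p) =
        of_real A + of_real B * (of_real (2 * p) * v powr (of_real (2 * p) - 1))"
    proof -
      have "v powr (of_real (2 * p) - 1) = v powr of_real (2 * p) / v"
        using v0 by (simp add: powr_diff)
      then have "of_real (2 * p) * (of_real A * v + of_real B * v powr of_real (2 * p)) / v + of_real (1 - p) =
          of_real (2 * p * A + (1 - p)) + of_real B * (of_real (2 * p) * v powr (of_real (2 * p) - 1))"
        using v0 by (simp add: field_simps)
      then show ?thesis unfolding A .
    qed
    moreover have "recip_gf p = (\<lambda>v. of_real A * v + of_real B * v powr of_real (2 * p))"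
      using False by (simp add: recip_gf_def fun_eq_iff A_def B_def)
    ultimately show ?thesis by (simp only:)
  qed
qed

lemma recip_gf_holomorphic: "recip_gf p holomorphic_on - \<real>\<^sub>\<le>\<^sub>0"
  using recip_gf_deriv holomorphic_on_open[OF open_slit] by blast

context
  fixes p :: real
  assumes p: "0 < p" "p < 1"
begin

lemma gf_root_bounds: "0 < gf_root p" "gf_root p < 1"
proof -
  show "0 < gf_root p" using p by (auto simp: gf_root_def)
  consider "p = 1/2" | "p < 1/2" | "p > 1/2" by linarith
  then show "gf_root p < 1"
  proof cases
    case 2
    then have "(p / (1 - p)) powr (1 / (1 - 2 * p)) < 1 powr (1 / (1 - 2 * p))"
      using p by (intro powr_less_mono2) auto
    then show ?thesis using 2 by (simp add: gf_root_def)
  next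
    case 3
    then have "(p / (1 - p)) powr (1 / (1 - 2 * p)) < 1 powr (1 / (1 - 2 * p))"
      using p by (intro powr_less_mono2_neg) (auto simp: field_simps)
    then show ?thesis using 3 by (simp add: gf_root_def)
  qed (simp add: gf_root_def)
qed

text \<open>Off the slit \<open>|Im (Ln v)| < pi\<close>, and \<open>|2 p - 1| < 1\<close> keeps the
  imaginary part of \<open>(2 p - 1) Ln v\<close> in that strip, where \<open>exp\<close> is
  injective. Hence \<open>v^(2p - 1) = (1 - p) / p\<close> has only its positive real solution. For
  \<open>p = 1/2\<close> the equation is \<open>Ln v = - 2\<close>.\<close>

lemma recip_gf_eq_0_iff:
  assumes v: "v \<in> - \<real>\<^sub>\<le>\<^sub>0"
  shows "recip_gf p v = 0 \<longleftrightarrow> v = of_real (gf_root p)"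
proof -
  have v0: "v \<noteq> 0" using v by auto
  have Im: "\<bar>Im (Ln v)\<bar> < pi"
    using Im_Ln_less_pi[of v] mpi_less_Im_Ln[OF v0] v by auto
  show ?thesis
  proof (cases "p = 1/2")
    case True
    have "recip_gf p v = 0 \<longleftrightarrow> Ln v = of_real (-2)"
      using v0 True by (auto simp: recip_gf_def add_eq_0_iff)
    also have "\<dots> \<longleftrightarrow> v = exp (of_real (-2))"
      using v0 by (metis Ln_exp Im_complex_of_real exp_Ln less_eq_real_def neg_less_0_iff_less pi_gt_zero)
    finally show ?thesis unfolding True by (simp add: gf_root_def exp_of_real[symmetric])
  next
    case False
    define x where "x = ln ((1 - p) / p)"
    have root: "gf_root p = exp (x / (2 * p - 1))"
    proof -
      have "x / (2 * p - 1) = (1 / (1 - 2 * p)) * ln (p / (1 - p))"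
        using p False by (simp add: x_def ln_div divide_simps) (simp add: algebra_simps)
      then show ?thesis using p False by (simp add: gf_root_def powr_def)
    qed
    have "recip_gf p v = 0 \<longleftrightarrow> v powr of_real (2 * p - 1) = of_real ((1 - p) / p)"
    proof -
      have "of_real ((1 - p) / (1 - 2 * p)) + of_real (p / (2 * p - 1)) * w =
          complex_of_real (p / (2 * p - 1)) * (w - of_real ((1 - p) / p))" for w
      proof -
        have "(1 - p) / (1 - 2 * p) = - (p / (2 * p - 1) * ((1 - p) / p))"
          using p False by (simp add: divide_simps) (simp add: algebra_simps)
        then show ?thesis by (simp only: of_real_minus of_real_mult right_diff_distrib) simp
      qed
      then show ?thesis using v0 p False unfolding recip_gf_factor[OF v0 False] by auto
    qed
    also have "\<dots> \<longleftrightarrow> exp (of_real (2 * p - 1) * Ln v) = exp (of_real x)"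
      using v0 p by (simp add: powr_def x_def exp_of_real)
    also have "\<dots> \<longleftrightarrow> of_real (2 * p - 1) * Ln v = of_real x"
    proof
      assume *: "exp (of_real (2 * p - 1) * Ln v) = exp (of_real x)"
      have "\<bar>Im (of_real (2 * p - 1) * Ln v)\<bar> \<le> 1 * \<bar>Im (Ln v)\<bar>"
      proof -
        have "Im (of_real (2 * p - 1) * Ln v) = (2 * p - 1) * Im (Ln v)" by simp
        then show ?thesis using p by (simp only: abs_mult) (intro mult_right_mono, auto)
      qed
      then have "Ln (exp (of_real (2 * p - 1) * Ln v)) = of_real (2 * p - 1) * Ln v"
        using Im by (intro Ln_exp) auto
      moreover have "Ln (exp (of_real x)) = complex_of_real x" by (intro Ln_exp) auto
      ultimately show "of_real (2 * p - 1) * Ln v = of_real x" using * by simp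
    qed simp
    also have "\<dots> \<longleftrightarrow> Ln v = of_real (x / (2 * p - 1))"
    proof -
      have "complex_of_real (2 * p - 1) \<noteq> 0" using False by (simp del: of_real_diff)
      then show ?thesis by (simp only: of_real_divide eq_divide_eq mult.commute not_False_eq_True if_True)
    qed
    also have "\<dots> \<longleftrightarrow> v = exp (of_real (x / (2 * p - 1)))"
      using v0 by (metis Ln_exp Im_complex_of_real exp_Ln less_eq_real_def neg_less_0_iff_less pi_gt_zero)
    finally show ?thesis by (simp only: root exp_of_real)
  qed
qed

lemma gf_root_slit: "complex_of_real (gf_root p) \<in> - \<real>\<^sub>\<le>\<^sub>0"
  using gf_root_bounds by (simp add: complex_nonpos_Reals_iff)

text \<open>At the zero the differential equation gives the derivative \<open>1 - p\<close>, so the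
  zero is simple and \<open>1 / recip_gf\<close> has residue \<open>1 / (1 - p)\<close> in
  \<open>v\<close>. Subtracting the polar part leaves a function that extends
  holomorphically.\<close>

lemma gf_without_pole:
  obtains g where "g holomorphic_on - \<real>\<^sub>\<le>\<^sub>0"
    "\<And>v. v \<in> - \<real>\<^sub>\<le>\<^sub>0 \<Longrightarrow> v \<noteq> of_real (gf_root p) \<Longrightarrow>
       g v = 1 / recip_gf p v - 1 / (of_real (1 - p) * (v - of_real (gf_root p)))"
proof -
  define c where "c = complex_of_real (gf_root p)"
  define d where "d = complex_of_real (1 - p)"
  define S where "S = - (\<real>\<^sub>\<le>\<^sub>0 :: complex set)"
  have d0: "d \<noteq> 0" using p by (simp add: d_def del: of_real_diff)
  have uc: "recip_gf p c = 0" using recip_gf_eq_0_iff[OF gf_root_slit] by (simp add: c_def)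
  have c: "c \<in> S" using gf_root_slit by (simp add: c_def S_def)
  have du: "deriv (recip_gf p) c = d"
    using recip_gf_deriv[of c p] c by (intro DERIV_imp_deriv) (simp add: S_def uc d_def)
  \<comment> \<open>\<open>w\<close> is \<open>recip_gf\<close> with its zero divided out. It is
    zero-free, so \<open>1 / w\<close> is holomorphic, and its difference quotient at
    \<open>c\<close> is the required \<open>g\<close>.\<close>
  define w where "w v = (if v = c then d else recip_gf p v / (v - c))" for v
  have "(\<lambda>v. if v = c then deriv (recip_gf p) c else (recip_gf p v - recip_gf p c) / (v - c)) holomorphic_on S"
    by (rule pole_lemma_open) (use recip_gf_holomorphic open_slit in \<open>auto simp: S_def\<close>)
  also have "(\<lambda>v. if v = c then deriv (recip_gf p) c else (recip_gf p v - recip_gf p c) / (v - c)) = w"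
    unfolding uc du by (simp add: w_def fun_eq_iff)
  finally have "w holomorphic_on S" .
  moreover have "w v \<noteq> 0" if "v \<in> S" for v
    using that recip_gf_eq_0_iff[of v] d0 by (auto simp: w_def S_def c_def)
  ultimately have "(\<lambda>v. 1 / w v) holomorphic_on S" by (intro holomorphic_intros) auto
  then have hol: "(\<lambda>v. if v = c then deriv (\<lambda>v. 1 / w v) c else (1 / w v - 1 / w c) / (v - c)) holomorphic_on S"
    by (rule pole_lemma_open) (simp add: S_def open_slit)
  show ?thesis
  proof (rule that[OF hol[unfolded S_def]])
    fix v assume "v \<in> - (\<real>\<^sub>\<le>\<^sub>0 :: complex set)" "v \<noteq> of_real (gf_root p)"
    then have "v \<noteq> c" "recip_gf p v \<noteq> 0" using recip_gf_eq_0_iff[of v] by (auto simp: c_def)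
    then show "(if v = c then deriv (\<lambda>v. 1 / w v) c else (1 / w v - 1 / w c) / (v - c)) =
       1 / recip_gf p v - 1 / (of_real (1 - p) * (v - of_real (gf_root p)))"
      using d0 unfolding c_def[symmetric] d_def[symmetric] by (simp add: w_def field_simps)
  qed
qed

text \<open>\<open>1 / recip_gf p (1 - z)\<close> solves the Bernoulli equation analytically near 0.
  Its Taylor series therefore solves the formal equation with constant term 1, which forces the
  coefficients to be the expected values.\<close>

lemma gf_fps_expansion:
  obtains F where "(\<lambda>z. 1 / recip_gf p (1 - z)) has_fps_expansion F"
    "\<And>n. fps_nth F (n - 1) = of_real (expected_paths p n)"
proof -
  define D where "D = {z. 1 - z \<in> - (\<real>\<^sub>\<le>\<^sub>0 :: complex set)} - {1 - of_real (gf_root p)}"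
  define f where "f z = 1 / recip_gf p (1 - z)" for z
  define F where "F = fps_expansion f 0"
  have "open ((\<lambda>z. 1 - z) -` (- (\<real>\<^sub>\<le>\<^sub>0 :: complex set)))"
    by (intro continuous_open_vimage open_slit continuous_intros)
  then have opD: "open D" unfolding D_def by (intro open_Diff) (auto simp: vimage_def)
  have "1 \<noteq> complex_of_real (gf_root p)" using gf_root_bounds by (metis less_irrefl of_real_eq_1_iff)
  then have D0: "0 \<in> D" by (simp add: D_def)
  have nz: "recip_gf p (1 - z) \<noteq> 0" if "z \<in> D" for z
    using that recip_gf_eq_0_iff[of "1 - z"] by (auto simp: D_def algebra_simps)
  have df: "(f has_field_derivative (of_real (2 * p) * f z * inverse (1 - z) + of_real (1 - p) * f z ^ 2)) (at z)"
    if z: "z \<in> D" for z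
  proof -
    define U where "U = recip_gf p (1 - z)"
    define A B where "A = complex_of_real (2 * p)" and "B = complex_of_real (1 - p)"
    have *: "(recip_gf p has_field_derivative (A * U / (1 - z) + B)) (at (1 - z))"
      unfolding U_def A_def B_def using z by (intro recip_gf_deriv) (auto simp: D_def)
    have U: "U \<noteq> 0" using nz[OF z] by (simp add: U_def)
    have z1: "1 - z \<noteq> 0" using z by (auto simp: D_def)
    have "((\<lambda>z. recip_gf p (1 - z)) has_field_derivative (A * U / (1 - z) + B) * (- 1)) (at z)"
      by (rule DERIV_chain2[where f = "recip_gf p" and g = "\<lambda>z. 1 - z", OF *]) (auto intro!: derivative_eq_intros)
    then have "((\<lambda>z. inverse (recip_gf p (1 - z))) has_field_derivative
        - (inverse U * ((A * U / (1 - z) + B) * (- 1)) * inverse U)) (at z)"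
      unfolding U_def by (rule DERIV_inverse') (use U in \<open>simp add: U_def\<close>)
    moreover have "- (inverse U * ((A * U / (1 - z) + B) * (- 1)) * inverse U) =
        A * inverse U * inverse (1 - z) + B * inverse U ^ 2"
      using U z1 by (simp add: field_simps power2_eq_square)
    ultimately show ?thesis
      by (simp add: f_def[abs_def] divide_inverse A_def B_def U_def)
  qed
  have hol: "f holomorphic_on D" using df holomorphic_on_open[OF opD] by blast
  have F: "f has_fps_expansion F" unfolding F_def by (rule has_fps_expansion_fps_expansion[OF opD D0 hol])
  have F0: "fps_nth F 0 = 1"
    unfolding fps_nth_fps_expansion[OF F] by (simp add: f_def)
  have "deriv f has_fps_expansion fps_deriv F" by (rule has_fps_expansion_deriv[OF F])
  moreover have "deriv f has_fps_expansion (fps_const (of_real (2 * p)) * F * inverse (1 - fps_X) + fps_const (of_real (1 - p)) * (F * F))"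
  proof -
    have "(\<lambda>z. of_real (2 * p) * f z * inverse (1 - z) + of_real (1 - p) * (f z * f z)) has_fps_expansion
        (fps_const (of_real (2 * p)) * F * inverse (1 - fps_X) + fps_const (of_real (1 - p)) * (F * F))"
      by (intro has_fps_expansion_add has_fps_expansion_mult has_fps_expansion_const F has_fps_expansion_inverse
         has_fps_expansion_diff has_fps_expansion_1 has_fps_expansion_fps_X) simp
    moreover have "eventually (\<lambda>z. deriv f z = of_real (2 * p) * f z * inverse (1 - z) + of_real (1 - p) * (f z * f z)) (nhds 0)"
      using eventually_nhds_in_open[OF opD D0] by eventually_elim (simp add: DERIV_imp_deriv[OF df] power2_eq_square)
    ultimately show ?thesis by (subst has_fps_expansion_cong[OF _ refl])
  qed
  ultimately have "fps_deriv F = fps_const (of_real (2 * p)) * F * inverse (1 - fps_X) + fps_const (of_real (1 - p)) * F ^ 2"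
    using fps_expansion_unique_complex unfolding power2_eq_square by blast
  then have "fps_nth F (n - 1) = of_real (expected_paths p n)" for n
    by (rule expected_paths_eq_complex_fps_nth[OF p F0])
  with F show ?thesis unfolding f_def[abs_def] by (rule that)
qed

end

section \<open>Removal of the pole and of the leading singular term\<close>

lemma sector_subset_slit: "- norm v / 3 \<le> Re v \<Longrightarrow> v \<noteq> 0 \<Longrightarrow> v \<in> - (\<real>\<^sub>\<le>\<^sub>0 :: complex set)"
proof
  assume v: "- norm v / 3 \<le> Re v" "v \<noteq> 0" and "v \<in> \<real>\<^sub>\<le>\<^sub>0"
  then have "norm v = - Re v" by (auto simp: complex_nonpos_Reals_iff cmod_def)
  moreover have "norm v > 0" using v by simp
  ultimately show False using v by linarith
qed

lemma one_minus_powr_has_fps_expansion: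
  "(\<lambda>z. (1 - z) powr a) has_fps_expansion fps_one_minus_powr (a :: complex)"
proof -
  have "((\<lambda>x. (1 + x) powr a) \<circ> (\<lambda>z. - z)) has_fps_expansion (fps_binomial a oo (- fps_X))"
    by (intro has_fps_expansion_compose has_fps_expansion_binomial_complex has_fps_expansion_minus
        has_fps_expansion_fps_X) simp
  then show ?thesis by (simp add: fps_one_minus_powr_def o_def)
qed

lemma inverse_const_minus_fps_X_nth:
  fixes a :: "'a::field"
  assumes "a \<noteq> 0"
  shows "fps_nth (inverse (fps_const a - fps_X)) m = 1 / a ^ Suc m"
proof -
  have "inverse (fps_const a - fps_X) = Abs_fps (\<lambda>m. 1 / a ^ Suc m)"
  proof (rule fps_inverse_unique, rule fps_ext)
    fix n show "fps_nth ((fps_const a - fps_X) * Abs_fps (\<lambda>m. 1 / a ^ Suc m)) n = fps_nth 1 n"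
      using assms by (cases n) (simp_all add: left_diff_distrib)
  qed
  then show ?thesis by simp
qed

text \<open>\<open>k\<^sub>0\<close> is minus the value of the polar term at \<open>v = 0\<close>.
  Subtracting it from \<open>g\<close> removes the constant that the polar term leaves at the
  origin, which matters when \<open>\<beta>\<close> is negative; a constant changes only the
  coefficient of order 0.\<close>

context
  fixes p :: real and g :: "complex \<Rightarrow> complex" and k\<^sub>0 :: complex
  assumes p: "0 < p" "p < 1"
    and g_hol: "g holomorphic_on - \<real>\<^sub>\<le>\<^sub>0"
    and g_eq: "\<And>v. v \<in> - \<real>\<^sub>\<le>\<^sub>0 \<Longrightarrow> v \<noteq> of_real (gf_root p) \<Longrightarrow>
       g v = 1 / recip_gf p v - 1 / (of_real (1 - p) * (v - of_real (gf_root p)))"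
  defines "k\<^sub>0 \<equiv> of_real (1 / ((1 - p) * gf_root p))"
begin

text \<open>The coefficient of order \<open>n - 1\<close> of \<open>g - k\<^sub>0 - l\<close> is the
  expectation minus the contributions of the pole and of \<open>l\<close>, and
  \<open>transfer_coeff_bound\<close> estimates it. The bound is asked for one fixed
  \<open>n\<close>, so \<open>l\<close> and \<open>M\<close> may depend on \<open>n\<close>; the
  case \<open>p = 1/2\<close> relies on this.\<close>

lemma expected_paths_transfer:
  fixes \<beta> M :: real and n :: nat
  assumes l_hol: "l holomorphic_on - \<real>\<^sub>\<le>\<^sub>0"
    and l_fps: "(\<lambda>z. l (1 - z)) has_fps_expansion L"
    and M: "M \<ge> 0" and \<beta>: "\<beta> \<ge> -1" and n: "n \<ge> 4"
    and bd: "\<And>v. - norm v / 3 \<le> Re v \<Longrightarrow> 1 / (2 * real n) \<le> norm v \<Longrightarrow>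
        norm v \<le> 3 \<Longrightarrow> norm (g v - k\<^sub>0 - l v) \<le> M * norm v powr (- \<beta>)"
  shows "norm (of_real (expected_paths p n - 1 / (1 - p) * growth_rate p ^ n) - fps_nth L (n - 1)) \<le>
    (384 * 11 * exp 2 * 2 powr \<bar>\<beta>\<bar>) * M * real n powr (\<beta> - 1)"
proof -
  define c where "c = gf_root p"
  define h where "h z = g (1 - z) - k\<^sub>0 - l (1 - z)" for z
  have c: "0 < c" "c < 1" using gf_root_bounds[OF p] by (auto simp: c_def)
  obtain F where F: "(\<lambda>z. 1 / recip_gf p (1 - z)) has_fps_expansion F"
    "\<And>n. fps_nth F (n - 1) = of_real (expected_paths p n)"
    using gf_fps_expansion[OF p] by blast
  define Q where "Q = fps_const (of_real (1 / (1 - p))) * inverse (fps_const (complex_of_real (1 - c)) - fps_X)"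
  have c1: "complex_of_real (1 - c) \<noteq> 0" using c by (simp del: of_real_diff)
  have Q: "(\<lambda>z. of_real (1 / (1 - p)) * inverse (of_real (1 - c) - z)) has_fps_expansion Q"
    unfolding Q_def using c1
    by (intro has_fps_expansion_mult has_fps_expansion_const has_fps_expansion_inverse
        has_fps_expansion_diff has_fps_expansion_fps_X) simp
  \<comment> \<open>The pole lies at \<open>z = 1 - c\<close>, so up to the factor
    \<open>1 / (1 - p)\<close> the coefficient of order \<open>n - 1\<close> is
    \<open>(1 - c)^(-n)\<close>, that is \<open>growth_rate p ^ n\<close>.\<close>
  have Q_nth: "fps_nth Q (n - 1) = of_real (1 / (1 - p) * growth_rate p ^ n)"
  proof -
    have "fps_nth Q (n - 1) = of_real (1 / (1 - p)) * (1 / of_real (1 - c) ^ n)"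
      using n unfolding Q_def by (simp only: fps_mult_left_const_nth inverse_const_minus_fps_X_nth[OF c1]) simp
    also have "\<dots> = of_real (1 / (1 - p) * growth_rate p ^ n)"
      unfolding growth_rate_eq c_def[symmetric] by (simp add: power_divide)
    finally show ?thesis .
  qed
  have "(\<lambda>z. 1 / recip_gf p (1 - z) - of_real (1 / (1 - p)) * inverse (of_real (1 - c) - z) - k\<^sub>0 - l (1 - z))
      has_fps_expansion F - Q - fps_const k\<^sub>0 - L"
    by (intro has_fps_expansion_diff has_fps_expansion_const F(1) Q l_fps)
  also have "?this \<longleftrightarrow> h has_fps_expansion F - Q - fps_const k\<^sub>0 - L"
  proof (rule has_fps_expansion_cong[OF _ refl])
    have "eventually (\<lambda>z. z \<in> ball 0 (1 - c)) (nhds (0::complex))"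
      using c by (intro eventually_nhds_in_open) auto
    then show "eventually (\<lambda>z. 1 / recip_gf p (1 - z) - of_real (1 / (1 - p)) * inverse (of_real (1 - c) - z) - k\<^sub>0 - l (1 - z) = h z) (nhds 0)"
    proof eventually_elim
      case (elim z)
      then have "Re z < 1 - c" using complex_Re_le_cmod[of z] by simp
      then have "1 - z \<in> - \<real>\<^sub>\<le>\<^sub>0" "1 - z \<noteq> of_real c"
        using c by (auto simp: complex_nonpos_Reals_iff complex_eq_iff)
      then have "g (1 - z) = 1 / recip_gf p (1 - z) - 1 / (of_real (1 - p) * (1 - z - of_real c))"
        using g_eq unfolding c_def by blast
      also have "1 / (of_real (1 - p) * (1 - z - of_real c)) = of_real (1 / (1 - p)) * inverse (of_real (1 - c) - z)"
      proof -
        have "of_real (1 - c) - z = 1 - z - of_real c" by simp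
        then show ?thesis by (simp only: divide_inverse inverse_mult_distrib mult_1_left of_real_inverse)
      qed
      finally show ?case by (simp add: h_def)
    qed
  qed
  finally have H: "h has_fps_expansion F - Q - fps_const k\<^sub>0 - L" .
  have "norm ((deriv ^^ (n - 1)) h 0 / fact (n - 1)) \<le>
    (384 * 11 * exp 2 * 2 powr \<bar>\<beta>\<bar>) * M * real n powr (\<beta> - 1)"
  proof (rule transfer_coeff_bound[OF _ M \<beta> n])
    have "(\<lambda>z. f (1 - z)) holomorphic_on {w. 1 - w \<notin> \<real>\<^sub>\<le>\<^sub>0}" if "f holomorphic_on - \<real>\<^sub>\<le>\<^sub>0" for f :: "complex \<Rightarrow> complex"
    proof -
      have "f \<circ> (\<lambda>z. 1 - z) holomorphic_on {w. 1 - w \<notin> \<real>\<^sub>\<le>\<^sub>0}"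
        by (rule holomorphic_on_compose_gen[OF _ that]) (auto intro!: holomorphic_intros)
      then show ?thesis by (simp add: o_def)
    qed
    then show "h holomorphic_on {w. 1 - w \<notin> \<real>\<^sub>\<le>\<^sub>0}"
      unfolding h_def[abs_def] using g_hol l_hol by (intro holomorphic_intros) blast+
  qed (use bd in \<open>auto simp: h_def\<close>)
  also have "(deriv ^^ (n - 1)) h 0 / fact (n - 1) =
      of_real (expected_paths p n - 1 / (1 - p) * growth_rate p ^ n) - fps_nth L (n - 1)"
    unfolding fps_nth_fps_expansion[OF H, symmetric] fps_sub_nth F(2) Q_nth
    using n by simp
  finally show ?thesis .
qed

text \<open>Only the behaviour at \<open>v = 0\<close> has to be checked. The rest of the sector up
  to radius 3 is compact and avoids the slit, so continuity bounds the function there. Near 0 the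
  polar term together with \<open>k\<^sub>0\<close> is of size \<open>|v|\<close>, which
  \<open>\<beta> \<ge> -1\<close> absorbs.\<close>

lemma remainder_bound:
  fixes \<beta> C \<delta> :: real
  assumes l_hol: "l holomorphic_on - \<real>\<^sub>\<le>\<^sub>0" and \<beta>: "\<beta> \<ge> -1" and \<delta>: "\<delta> > 0"
    and near: "\<And>v. - norm v / 3 \<le> Re v \<Longrightarrow> v \<noteq> 0 \<Longrightarrow> norm v \<le> \<delta> \<Longrightarrow>
        norm (1 / recip_gf p v - l v) \<le> C * norm v powr (- \<beta>)"
  shows "\<exists>M\<ge>0. \<forall>v. - norm v / 3 \<le> Re v \<longrightarrow> v \<noteq> 0 \<longrightarrow> norm v \<le> 3 \<longrightarrow>
        norm (g v - k\<^sub>0 - l v) \<le> M * norm v powr (- \<beta>)"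
proof -
  define c where "c = gf_root p"
  have c: "0 < c" "c < 1" using gf_root_bounds[OF p] by (auto simp: c_def)
  \<comment> \<open>Staying within half the distance from 0 to the zero \<open>c\<close> keeps
    \<open>|v - c|\<close> at least \<open>c / 2\<close>, and also \<open>|v| < 1\<close>.\<close>
  define \<epsilon> where "\<epsilon> = min \<delta> (c / 2)"
  have \<epsilon>: "\<epsilon> > 0" "\<epsilon> \<le> \<delta>" "\<epsilon> \<le> c / 2" using \<delta> c by (auto simp: \<epsilon>_def)
  define S where "S = {v::complex. - norm v / 3 \<le> Re v}"
  define K where "K = S \<inter> (cball 0 3 - ball 0 \<epsilon>)"
  have "closed S" unfolding S_def by (intro closed_Collect_le continuous_intros) auto
  then have "compact K" unfolding K_def
    by (intro closed_Int_compact compact_diff) auto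
  have K_sub: "K \<subseteq> - \<real>\<^sub>\<le>\<^sub>0"
    using sector_subset_slit \<epsilon> by (force simp: K_def S_def)
  have "continuous_on K (\<lambda>v. norm (g v - k\<^sub>0 - l v) * norm v powr \<beta>)"
    using K_sub \<epsilon>
    by (intro continuous_intros holomorphic_on_imp_continuous_on holomorphic_on_subset[OF g_hol]
        holomorphic_on_subset[OF l_hol]) (auto simp: K_def)
  then have "bounded ((\<lambda>v. norm (g v - k\<^sub>0 - l v) * norm v powr \<beta>) ` K)"
    by (intro compact_imp_bounded compact_continuous_image \<open>compact K\<close>)
  then obtain B where B: "\<And>v. v \<in> K \<Longrightarrow> norm (g v - k\<^sub>0 - l v) * norm v powr \<beta> \<le> B"
    by (auto simp: bounded_iff)
  define M where "M = max 0 (max B (C + 2 / ((1 - p) * c ^ 2)))"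
  show ?thesis
  proof (intro exI[of _ M] conjI allI impI)
    show "0 \<le> M" by (simp add: M_def)
    fix v assume v: "- norm v / 3 \<le> Re v" "v \<noteq> 0" "norm v \<le> 3"
    show "norm (g v - k\<^sub>0 - l v) \<le> M * norm v powr (- \<beta>)"
    proof (cases "norm v < \<epsilon>")
      case False
      then have "v \<in> K" using v by (auto simp: K_def S_def)
      have "norm (g v - k\<^sub>0 - l v) = (norm (g v - k\<^sub>0 - l v) * norm v powr \<beta>) * norm v powr (- \<beta>)"
        using v by (simp add: powr_minus)
      also have "\<dots> \<le> M * norm v powr (- \<beta>)"
        using B[OF \<open>v \<in> K\<close>] by (intro mult_right_mono) (auto simp: M_def)
      finally show ?thesis .
    next
      case True
      have gen: "x = a - b \<Longrightarrow> b + k = y \<Longrightarrow> x - k - l = (a - l) - y" for x a b k l y :: complex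
        by auto
      define w where "w = v - of_real c"
      have w: "norm w \<ge> c / 2"
        using norm_triangle_ineq2[of "of_real c" v] True \<epsilon> c by (simp add: w_def norm_minus_commute)
      then have w0: "w \<noteq> 0" using c by auto
      then have "g v = 1 / recip_gf p v - 1 / (of_real (1 - p) * w)"
        unfolding w_def c_def using sector_subset_slit[OF v(1,2)] by (intro g_eq) auto
      moreover have "1 / (of_real (1 - p) * w) + k\<^sub>0 = v / (of_real ((1 - p) * c) * w)"
      proof -
        have "complex_of_real (1 - p) \<noteq> 0" "complex_of_real c \<noteq> 0" using p c by (simp_all del: of_real_diff)
        moreover have "v = w + of_real c" by (simp add: w_def)
        ultimately show ?thesis using w0
          unfolding k\<^sub>0_def c_def[symmetric] of_real_divide of_real_mult by (simp add: divide_simps) 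
      qed
      ultimately have "g v - k\<^sub>0 - l v = (1 / recip_gf p v - l v) - v / (of_real ((1 - p) * c) * w)"
        by (rule gen)
      then have "norm (g v - k\<^sub>0 - l v) \<le> norm (1 / recip_gf p v - l v) + norm (v / (of_real ((1 - p) * c) * w))"
        by (metis norm_triangle_ineq4)
      also have "norm (v / (of_real ((1 - p) * c) * w)) = norm v / ((1 - p) * c * norm w)"
        using p c by (simp add: norm_divide norm_mult del: of_real_diff)
      also have "\<dots> \<le> norm v / ((1 - p) * c * (c / 2))"
        using p c w w0 by (intro divide_left_mono mult_left_mono mult_pos_pos) auto
      also have "\<dots> = 2 / ((1 - p) * c ^ 2) * norm v" by (simp add: power2_eq_square mult_ac)
      also have "\<dots> \<le> 2 / ((1 - p) * c ^ 2) * norm v powr (- \<beta>)"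
      proof -
        have "norm v powr 1 \<le> norm v powr (- \<beta>)"
          using \<beta> v True \<epsilon> c by (intro powr_mono') auto
        then show ?thesis using p v by (intro mult_left_mono) auto
      qed
      finally have "norm (g v - k\<^sub>0 - l v) \<le> (C + 2 / ((1 - p) * c ^ 2)) * norm v powr (- \<beta>)"
        using near[OF v(1,2)] True \<epsilon> by (simp add: distrib_right)
      also have "\<dots> \<le> M * norm v powr (- \<beta>)" by (intro mult_right_mono) (auto simp: M_def)
      finally show ?thesis .
    qed
  qed
qed

end

subsection \<open>Asymptotics in the three regimes\<close>

lemma norm_inverse_one_minus_minus_1:
  fixes y :: complex
  assumes "norm y \<le> 1/2"
  shows "norm (1 / (1 - y) - 1) \<le> 2 * norm y"
proof -
  have "norm (1 - y) \<ge> 1/2" using norm_triangle_ineq2[of 1 y] assms by simp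
  moreover from this have "1 - y \<noteq> 0" by auto
  then have "1 / (1 - y) - 1 = y / (1 - y)" by (simp add: field_simps)
  ultimately show ?thesis
    using mult_left_mono[of "1/2" "norm (1 - y)" "norm y"]
    by (simp add: norm_divide divide_simps)
qed

lemma one_over_mult_one_minus_diff:
  fixes b y :: "'a::field"
  shows "1 / (b * (1 - y)) - inverse b = inverse b * (1 / (1 - y) - 1)"
  unfolding divide_inverse inverse_mult_distrib by (simp add: algebra_simps)

lemma small_mult_powr:
  fixes a b :: real
  assumes "a > 0" "b > 0"
  shows "\<exists>\<delta>>0. \<forall>x. 0 < x \<longrightarrow> x \<le> \<delta> \<longrightarrow> b * x powr a \<le> 1/2"
proof (intro exI[of _ "(1 / (2 * b)) powr (1 / a)"] conjI allI impI)
  fix x :: real assume x: "0 < x" "x \<le> (1 / (2 * b)) powr (1 / a)"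
  then have "x powr a \<le> ((1 / (2 * b)) powr (1 / a)) powr a"
    using assms by (intro powr_mono2) auto
  also have "\<dots> = 1 / (2 * b)" using assms by (simp add: powr_powr)
  finally show "b * x powr a \<le> 1/2" using assms by (simp add: field_simps)
qed (use assms in simp)

lemma one_minus_powr_fps_nth:
  "fps_nth (fps_one_minus_powr (of_real (- s) :: complex)) m = of_real (pochhammer s m / fact m)"
  by (simp add: gbinomial_pochhammer pochhammer_of_real flip: of_real_minus power_mult_distrib)

text \<open>Gautschi's inequality, from the log-convexity of \<^const>\<open>Gamma\<close>.\<close>
lemma pochhammer_over_fact_bounds:
  fixes s :: real
  assumes s: "0 < s" "s < 1" and m: "m \<ge> 1"
  shows "pochhammer s m / fact m \<le> real m powr (s - 1) / Gamma s"
    and "real (Suc m) powr (s - 1) / Gamma s \<le> pochhammer s m / fact m"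
proof -
  define x where "x = real m"
  have x: "x \<ge> 1" using m by (simp add: x_def)
  have conv: "ln (Gamma ((1 - t) * a + t * b)) \<le> (1 - t) * ln (Gamma a) + t * ln (Gamma b)"
    if "0 \<le> t" "t \<le> 1" "a > 0" "b > 0" for t a b :: real
    using convex_onD[OF log_convex_Gamma_real, of t a b] that by simp
  have ln_Gamma_plus1: "ln (Gamma (y + 1)) = ln y + ln (Gamma y)" if "y > 0" for y :: real
  proof -
    have "y \<notin> \<int>\<^sub>\<le>\<^sub>0" using that by (auto elim!: nonpos_Ints_cases)
    moreover have "Gamma y \<noteq> 0" using Gamma_real_pos[OF that] by linarith
    ultimately show ?thesis using that by (simp add: Gamma_plus1 ln_mult)
  qed
  have G: "Gamma (x + s) > 0" "Gamma (x + 1) > 0" "Gamma s > 0" using x s by (auto intro: Gamma_real_pos)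
  then have Gnz: "Gamma (x + s) \<noteq> 0" "Gamma (x + 1) \<noteq> 0" by auto
  have eq: "pochhammer s m / fact m = Gamma (x + s) / Gamma (x + 1) / Gamma s"
  proof -
    have "s \<notin> \<int>\<^sub>\<le>\<^sub>0" using s by (auto elim!: nonpos_Ints_cases)
    then show ?thesis by (simp add: x_def pochhammer_Gamma Gamma_fact add.commute)
  qed
  \<comment> \<open>\<open>x + s\<close> is the convex combination of \<open>x\<close> and
    \<open>x + 1\<close> with weight \<open>s\<close>; the lower bound below writes
    \<open>x + 1\<close> as a combination of \<open>x + s\<close> and
    \<open>x + s + 1\<close>.\<close>
  have "ln (Gamma (x + s)) \<le> (1 - s) * ln (Gamma x) + s * ln (Gamma (x + 1))"
    using conv[of s x "x + 1"] s x by (simp add: algebra_simps)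
  also have "\<dots> = ln (Gamma (x + 1)) + (s - 1) * ln x"
    using ln_Gamma_plus1[of x] x by (simp add: algebra_simps)
  finally have "ln (Gamma (x + s) / Gamma (x + 1)) \<le> ln (x powr (s - 1))"
    using Gnz x by (simp add: ln_div ln_powr)
  then have "Gamma (x + s) / Gamma (x + 1) \<le> x powr (s - 1)"
    using G x by (subst (asm) ln_le_cancel_iff) auto
  then show "pochhammer s m / fact m \<le> real m powr (s - 1) / Gamma s"
    unfolding eq x_def[symmetric] using G by (intro divide_right_mono) auto
  have "ln (Gamma (x + 1)) \<le> s * ln (Gamma (x + s)) + (1 - s) * ln (Gamma (x + s + 1))"
    using conv[of "1 - s" "x + s" "x + s + 1"] s x by (simp add: algebra_simps)
  also have "\<dots> = ln (Gamma (x + s)) + (1 - s) * ln (x + s)"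
    using ln_Gamma_plus1[of "x + s"] x s by (simp add: algebra_simps)
  also have "\<dots> \<le> ln (Gamma (x + s)) + (1 - s) * ln (x + 1)"
    using s x by (intro add_left_mono mult_left_mono) auto
  finally have "ln ((x + 1) powr (s - 1)) \<le> ln (Gamma (x + s) / Gamma (x + 1))"
    using Gnz x by (simp add: ln_div ln_powr algebra_simps)
  then have "(x + 1) powr (s - 1) \<le> Gamma (x + s) / Gamma (x + 1)"
    using G x by (subst (asm) ln_le_cancel_iff) auto
  then show "real (Suc m) powr (s - 1) / Gamma s \<le> pochhammer s m / fact m"
    unfolding eq using G by (intro divide_right_mono) (auto simp: x_def add.commute)
qed

text \<open>Gautschi's bounds at \<open>m = n - 1\<close> squeeze the quotient between the powers at
  \<open>n\<close> and at \<open>n - 1\<close>, which differ by \<open>O(n^(s - 2))\<close>. This is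
  within the claimed error because \<open>s - 2 \<le> 2 (s - 1)\<close>.\<close>

lemma pochhammer_over_fact_asymp:
  fixes s :: real
  assumes s: "0 < s" "s < 1"
  shows "(\<lambda>n. pochhammer s (n - 1) / fact (n - 1) - real n powr (s - 1) / Gamma s) \<in> O(\<lambda>n. real n powr (2 * (s - 1)))"
proof -
  have "(\<lambda>n. pochhammer s (n - 1) / fact (n - 1) - real n powr (s - 1) / Gamma s) \<in>
      O(\<lambda>n. (real n - 1) powr (s - 1) - real n powr (s - 1))"
  proof (intro bigoI[of _ "1 / Gamma s"] eventually_mono[OF eventually_ge_at_top[of 2]])
    fix n :: nat assume n: "n \<ge> 2"
    then have m: "n - 1 \<ge> 1" by simp
    have G: "Gamma s > 0" using s by (auto intro: Gamma_real_pos)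
    have "real (Suc (n - 1)) = real n" "real (n - 1) = real n - 1" using n by auto
    note b = pochhammer_over_fact_bounds[OF s m, unfolded this]
    have "norm (pochhammer s (n - 1) / fact (n - 1) - real n powr (s - 1) / Gamma s) \<le>
        (real n - 1) powr (s - 1) / Gamma s - real n powr (s - 1) / Gamma s"
      using b by simp
    also have "\<dots> = 1 / Gamma s * ((real n - 1) powr (s - 1) - real n powr (s - 1))"
      by (simp add: diff_divide_distrib)
    also have "\<dots> \<le> 1 / Gamma s * norm ((real n - 1) powr (s - 1) - real n powr (s - 1))"
      using G by (intro mult_left_mono) auto
    finally show "norm (pochhammer s (n - 1) / fact (n - 1) - real n powr (s - 1) / Gamma s) \<le>
        1 / Gamma s * norm ((real n - 1) powr (s - 1) - real n powr (s - 1))" .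
  qed
  also have "(\<lambda>n. (real n - 1) powr (s - 1) - real n powr (s - 1)) \<in> O(\<lambda>n. real n powr (s - 2))"
    by real_asymp
  also have "(\<lambda>n. real n powr (s - 2)) \<in> O(\<lambda>n. real n powr (2 * (s - 1)))"
  proof (intro bigoI[of _ 1] eventually_mono[OF eventually_ge_at_top[of 1]])
    fix n :: nat assume "n \<ge> 1"
    then show "norm (real n powr (s - 2)) \<le> 1 * norm (real n powr (2 * (s - 1)))"
      using s by (simp, intro powr_mono) auto
  qed
  finally show ?thesis .
qed

lemma bigoI_from_4:
  assumes "\<And>n. n \<ge> 4 \<Longrightarrow> norm (f n) \<le> C * norm (g n)"
  shows "f \<in> O(g :: nat \<Rightarrow> real)"
  by (rule bigoI[of _ C]) (use eventually_ge_at_top[of 4] in eventually_elim, rule assms)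

lemma norm_powr_of_real: "norm (z powr complex_of_real a) = norm z powr a"
  by (simp add: norm_powr_real_powr')

section \<open>The power-law regimes, \<open>p\<close> below and above \<open>1/2\<close>\<close>

text \<open>For \<open>p < 1/2\<close> the term in \<open>v^(2p)\<close> dominates at
  \<open>v = 0\<close>, so \<open>1 / recip_gf\<close> is close to \<open>- A v^(-2p)\<close> with
  relative error of order \<open>|v|^(1 - 2p)\<close>. The product of both orders is
  \<open>|v|^(- \<beta>)\<close> with \<open>\<beta> = 4 p - 1\<close>, and transfer gives
  \<open>n^(\<beta> - 1)\<close>.\<close>

lemma asymp_less_half:
  assumes p: "0 < p" "p < 1/2"
  shows "(\<lambda>n. expected_paths p n - 1 / (1 - p) * growth_rate p ^ n -
      (- ((1 - 2 * p) / (p * Gamma (2 * p))) * real n powr (2 * p - 1))) \<in> O(\<lambda>n. real n powr (2 * (2 * p - 1)))"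
proof -
  have p1: "p < 1" using p by simp
  obtain g where g_hol: "g holomorphic_on - \<real>\<^sub>\<le>\<^sub>0" and
    g_eq: "\<And>v. v \<in> - \<real>\<^sub>\<le>\<^sub>0 \<Longrightarrow> v \<noteq> of_real (gf_root p) \<Longrightarrow>
       g v = 1 / recip_gf p v - 1 / (of_real (1 - p) * (v - of_real (gf_root p)))"
    using gf_without_pole[OF p(1) p1] by blast
  define A where "A = (1 - 2 * p) / p"
  define \<kappa> where "\<kappa> = (1 - p) / p"
  define \<beta> where "\<beta> = 4 * p - 1"
  define l where "l v = of_real (- A) * v powr of_real (- (2 * p))" for v :: complex
  have pos: "A > 0" "\<kappa> > 0" using p by (auto simp: A_def \<kappa>_def)
  have l_hol: "l holomorphic_on - \<real>\<^sub>\<le>\<^sub>0"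
    unfolding l_def by (intro holomorphic_intros) auto
  have l_fps: "(\<lambda>z. l (1 - z)) has_fps_expansion (fps_const (of_real (- A)) * fps_one_minus_powr (of_real (- (2 * p))))"
    unfolding l_def by (intro has_fps_expansion_mult has_fps_expansion_const one_minus_powr_has_fps_expansion)
  obtain \<delta> where \<delta>: "\<delta> > 0" "\<And>x. 0 < x \<Longrightarrow> x \<le> \<delta> \<Longrightarrow> \<kappa> * x powr (1 - 2 * p) \<le> 1/2"
    using small_mult_powr[of "1 - 2 * p" \<kappa>] pos p by auto
  have near: "norm (1 / recip_gf p v - l v) \<le> (2 * A * \<kappa>) * norm v powr (- \<beta>)"
    if v: "v \<noteq> 0" "norm v \<le> \<delta>" for v
  proof -
    \<comment> \<open>\<open>- y\<close> is the ratio of the subordinate term of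
      \<open>recip_gf\<close> to the dominant one.\<close>
    define y where "y = of_real \<kappa> * v powr of_real (1 - 2 * p)"
    have ny: "norm y = \<kappa> * norm v powr (1 - 2 * p)"
      using pos by (simp add: y_def norm_mult norm_powr_of_real del: of_real_diff)
    have y: "norm y \<le> 1/2" using \<delta>(2)[of "norm v"] v by (simp add: ny)
    have "recip_gf p v = of_real (- (1 / A)) * v powr of_real (2 * p) * (1 - y)"
    proof -
      have 1: "(1 - p) / (1 - 2 * p) = 1 / A * \<kappa>" "p / (2 * p - 1) = - (1 / A)"
        using p by (simp add: A_def \<kappa>_def divide_simps, simp add: algebra_simps)+
      have 2: "v = v powr of_real (2 * p) * v powr of_real (1 - 2 * p)"
        using v unfolding powr_add[symmetric] by simp
      have "recip_gf p v = of_real (1 / A * \<kappa>) * v + of_real (- (1 / A)) * v powr of_real (2 * p)"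
        using p unfolding recip_gf_def 1 by simp
      also have "of_real (1 / A * \<kappa>) * v = of_real (1 / A * \<kappa>) * (v powr of_real (2 * p) * v powr of_real (1 - 2 * p))"
        using 2 by simp
      finally show ?thesis by (simp add: y_def algebra_simps del: of_real_diff)
    qed
    moreover have "l v = inverse (of_real (- (1 / A)) * v powr of_real (2 * p))"
      using pos by (simp add: l_def powr_minus divide_inverse)
    ultimately have "1 / recip_gf p v - l v = l v * (1 / (1 - y) - 1)"
      by (simp only: one_over_mult_one_minus_diff)
    then have "norm (1 / recip_gf p v - l v) = A * norm v powr (- (2 * p)) * norm (1 / (1 - y) - 1)"
      using pos by (simp only: norm_mult l_def norm_powr_of_real) simp
    also have "\<dots> \<le> A * norm v powr (- (2 * p)) * (2 * norm y)"
      using pos norm_inverse_one_minus_minus_1[OF y] by (intro mult_left_mono) auto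
    also have "\<dots> = 2 * A * \<kappa> * (norm v powr (- (2 * p)) * norm v powr (1 - 2 * p))"
      by (simp add: ny)
    also have "norm v powr (- (2 * p)) * norm v powr (1 - 2 * p) = norm v powr (- \<beta>)"
      unfolding powr_add[symmetric] by (simp add: \<beta>_def)
    finally show ?thesis .
  qed
  have \<beta>: "\<beta> \<ge> -1" using p by (simp add: \<beta>_def)
  obtain M where M: "M \<ge> 0" "\<And>v. - norm v / 3 \<le> Re v \<Longrightarrow> v \<noteq> 0 \<Longrightarrow> norm v \<le> 3 \<Longrightarrow>
      norm (g v - of_real (1 / ((1 - p) * gf_root p)) - l v) \<le> M * norm v powr (- \<beta>)"
    using remainder_bound[OF p(1) p1 g_hol g_eq l_hol \<beta> \<delta>(1) near] by blast
  define K where "K = (384 * 11 * exp 2 * 2 powr \<bar>\<beta>\<bar>) * M"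
  \<comment> \<open>\<open>a n\<close> is the coefficient of order \<open>n - 1\<close> of
    \<open>(1 - z)^(-2p)\<close>; its own asymptotics introduces
    \<open>Gamma (2 * p)\<close>.\<close>
  define a where "a n = pochhammer (2 * p) (n - 1) / fact (n - 1)" for n
  have 1: "(\<lambda>n. expected_paths p n - 1 / (1 - p) * growth_rate p ^ n + A * a n) \<in> O(\<lambda>n. real n powr (2 * (2 * p - 1)))"
  proof (rule bigoI_from_4)
    fix n :: nat assume n: "n \<ge> 4"
    have "norm (complex_of_real (expected_paths p n - 1 / (1 - p) * growth_rate p ^ n) -
        fps_nth (fps_const (of_real (- A)) * fps_one_minus_powr (of_real (- (2 * p)))) (n - 1)) \<le> K * real n powr (\<beta> - 1)"
      unfolding K_def
    proof (rule expected_paths_transfer[OF p(1) p1 g_hol g_eq l_hol l_fps M(1) \<beta> n])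
      fix v assume v: "- norm v / 3 \<le> Re v" "1 / (2 * real n) \<le> norm v" "norm v \<le> 3"
      have "0 < 1 / (2 * real n)" using n by simp
      then have "v \<noteq> 0" using v by auto
      then show "norm (g v - of_real (1 / ((1 - p) * gf_root p)) - l v) \<le> M * norm v powr (- \<beta>)"
        using M(2) v by blast
    qed
    also have "fps_nth (fps_const (of_real (- A)) * fps_one_minus_powr (of_real (- (2 * p)))) (n - 1) = complex_of_real (- A * a n)"
      by (simp only: fps_mult_left_const_nth one_minus_powr_fps_nth a_def of_real_mult)
    also have "\<beta> - 1 = 2 * (2 * p - 1)" by (simp add: \<beta>_def)
    finally show "norm (expected_paths p n - 1 / (1 - p) * growth_rate p ^ n + A * a n) \<le> K * norm (real n powr (2 * (2 * p - 1)))"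
      by (simp only: of_real_diff[symmetric] norm_of_real) simp
  qed
  have "(\<lambda>n. a n - real n powr (2 * p - 1) / Gamma (2 * p)) \<in> O(\<lambda>n. real n powr (2 * (2 * p - 1)))"
    unfolding a_def using p by (intro pochhammer_over_fact_asymp) auto
  then have "(\<lambda>n. A * (a n - real n powr (2 * p - 1) / Gamma (2 * p))) \<in> O(\<lambda>n. real n powr (2 * (2 * p - 1)))"
    by simp
  from sum_in_bigo(2)[OF 1 this] show ?thesis
    by (simp add: A_def algebra_simps)
qed

text \<open>Now the linear term dominates: \<open>1 / recip_gf\<close> is close to
  \<open>- A / v\<close> with relative error of order \<open>|v|^(2p - 1)\<close>, whence
  \<open>\<beta> = 2 - 2 p\<close>. All coefficients of \<open>1 / (1 - z)\<close> are 1, so the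
  main term is the constant \<open>- A\<close>.\<close>

lemma asymp_greater_half:
  assumes p: "1/2 < p" "p < 1"
  shows "(\<lambda>n. expected_paths p n - 1 / (1 - p) * growth_rate p ^ n -
      (- ((2 * p - 1) / (1 - p)))) \<in> O(\<lambda>n. real n powr (1 - 2 * p))"
proof -
  have p0: "0 < p" using p by simp
  obtain g where g_hol: "g holomorphic_on - \<real>\<^sub>\<le>\<^sub>0" and
    g_eq: "\<And>v. v \<in> - \<real>\<^sub>\<le>\<^sub>0 \<Longrightarrow> v \<noteq> of_real (gf_root p) \<Longrightarrow>
       g v = 1 / recip_gf p v - 1 / (of_real (1 - p) * (v - of_real (gf_root p)))"
    using gf_without_pole[OF p0 p(2)] by blast
  define A where "A = (2 * p - 1) / (1 - p)"
  define \<kappa> where "\<kappa> = p / (1 - p)"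
  define \<beta> where "\<beta> = 2 - 2 * p"
  define l where "l v = of_real (- A) * inverse v" for v :: complex
  have pos: "A > 0" "\<kappa> > 0" using p by (auto simp: A_def \<kappa>_def)
  have l_hol: "l holomorphic_on - \<real>\<^sub>\<le>\<^sub>0"
    unfolding l_def by (intro holomorphic_intros) auto
  have l_fps: "(\<lambda>z. l (1 - z)) has_fps_expansion (fps_const (of_real (- A)) * inverse (1 - fps_X))"
    unfolding l_def by (intro has_fps_expansion_mult has_fps_expansion_const has_fps_expansion_inverse
      has_fps_expansion_diff has_fps_expansion_1 has_fps_expansion_fps_X) simp
  obtain \<delta> where \<delta>: "\<delta> > 0" "\<And>x. 0 < x \<Longrightarrow> x \<le> \<delta> \<Longrightarrow> \<kappa> * x powr (2 * p - 1) \<le> 1/2"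
    using small_mult_powr[of "2 * p - 1" \<kappa>] pos p by auto
  have near: "norm (1 / recip_gf p v - l v) \<le> (2 * A * \<kappa>) * norm v powr (- \<beta>)"
    if v: "v \<noteq> 0" "norm v \<le> \<delta>" for v
  proof -
    define y where "y = of_real \<kappa> * v powr of_real (2 * p - 1)"
    have ny: "norm y = \<kappa> * norm v powr (2 * p - 1)"
      using pos by (simp add: y_def norm_mult norm_powr_of_real del: of_real_diff)
    have y: "norm y \<le> 1/2" using \<delta>(2)[of "norm v"] v by (simp add: ny)
    have "recip_gf p v = of_real (- (1 / A)) * v * (1 - y)"
    proof -
      have "(1 - p) / (1 - 2 * p) = - (1 / A)"
        using p by (simp add: A_def divide_simps) (simp add: algebra_simps)
      moreover have "p / (2 * p - 1) = 1 / A * \<kappa>"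
        using p by (simp add: A_def \<kappa>_def)
      ultimately have 1: "(1 - p) / (1 - 2 * p) = - (1 / A)" "p / (2 * p - 1) = 1 / A * \<kappa>" .
      have "p \<noteq> 1/2" using p by simp
      then show ?thesis unfolding recip_gf_factor[OF v(1) \<open>p \<noteq> 1/2\<close>] 1
        by (simp add: y_def algebra_simps)
    qed
    moreover have "l v = inverse (of_real (- (1 / A)) * v)"
      using pos by (simp add: l_def divide_inverse)
    ultimately have "1 / recip_gf p v - l v = l v * (1 / (1 - y) - 1)"
      by (simp only: one_over_mult_one_minus_diff)
    then have "norm (1 / recip_gf p v - l v) = A * inverse (norm v) * norm (1 / (1 - y) - 1)"
      using pos by (simp only: norm_mult l_def norm_inverse) simp
    also have "\<dots> \<le> A * inverse (norm v) * (2 * norm y)"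
      using pos norm_inverse_one_minus_minus_1[OF y] by (intro mult_left_mono) auto
    also have "\<dots> = 2 * A * \<kappa> * (norm v powr (- 1) * norm v powr (2 * p - 1))"
      using v by (simp add: ny powr_minus)
    also have "norm v powr (- 1) * norm v powr (2 * p - 1) = norm v powr (- \<beta>)"
      unfolding powr_add[symmetric] by (simp add: \<beta>_def)
    finally show ?thesis .
  qed
  have \<beta>: "\<beta> \<ge> -1" using p by (simp add: \<beta>_def)
  obtain M where M: "M \<ge> 0" "\<And>v. - norm v / 3 \<le> Re v \<Longrightarrow> v \<noteq> 0 \<Longrightarrow> norm v \<le> 3 \<Longrightarrow>
      norm (g v - of_real (1 / ((1 - p) * gf_root p)) - l v) \<le> M * norm v powr (- \<beta>)"
    using remainder_bound[OF p0 p(2) g_hol g_eq l_hol \<beta> \<delta>(1) near] by blast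
  define K where "K = (384 * 11 * exp 2 * 2 powr \<bar>\<beta>\<bar>) * M"
  show ?thesis
  proof (rule bigoI_from_4)
    fix n :: nat assume n: "n \<ge> 4"
    have "norm (complex_of_real (expected_paths p n - 1 / (1 - p) * growth_rate p ^ n) -
        fps_nth (fps_const (of_real (- A)) * inverse (1 - fps_X)) (n - 1)) \<le> K * real n powr (\<beta> - 1)"
      unfolding K_def
    proof (rule expected_paths_transfer[OF p0 p(2) g_hol g_eq l_hol l_fps M(1) \<beta> n])
      fix v assume v: "- norm v / 3 \<le> Re v" "1 / (2 * real n) \<le> norm v" "norm v \<le> 3"
      have "0 < 1 / (2 * real n)" using n by simp
      then have "v \<noteq> 0" using v by auto
      then show "norm (g v - of_real (1 / ((1 - p) * gf_root p)) - l v) \<le> M * norm v powr (- \<beta>)"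
        using M(2) v by blast
    qed
    also have "fps_nth (fps_const (of_real (- A)) * inverse (1 - fps_X)) (n - 1) = complex_of_real (- A)"
      using inverse_const_minus_fps_X_nth[of "1::complex" "n - 1"] by simp
    also have "\<beta> - 1 = 1 - 2 * p" by (simp add: \<beta>_def)
    finally show "norm (expected_paths p n - 1 / (1 - p) * growth_rate p ^ n - (- ((2 * p - 1) / (1 - p)))) \<le> K * norm (real n powr (1 - 2 * p))"
      unfolding A_def by (simp only: of_real_diff[symmetric] norm_of_real) simp
  qed
qed

section \<open>The logarithmic regime \<open>p = 1/2\<close>\<close>

lemma ln_square_le:
  fixes x :: real
  assumes "x \<ge> 1"
  shows "(1 + ln x) ^ 2 \<le> 4 * x" "ln x ^ 2 \<le> 4 * x"
proof -
  have "ln (sqrt x) \<le> sqrt x - 1" using assms by (intro ln_le_minus_one) auto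
  then have "ln x \<le> 2 * sqrt x - 2" using assms by (simp add: ln_sqrt)
  then have *: "1 + ln x \<le> 2 * sqrt x" "ln x \<le> 2 * sqrt x" by auto
  show "(1 + ln x) ^ 2 \<le> 4 * x" "ln x ^ 2 \<le> 4 * x"
    using power_mono[OF *(1), of 2] power_mono[OF *(2), of 2] assms by (simp_all add: power_mult_distrib)
qed

text \<open>Serves to absorb the logarithmic losses of freezing into \<open>x = n * |v|\<close>,
  which is at least \<open>1/2\<close> in the range considered.\<close>

lemma abs_ln_poly_le:
  fixes x :: real
  assumes "x \<ge> 1/2"
  shows "(\<bar>ln x\<bar> + 4) * (1 + \<bar>ln x\<bar>) \<le> 20 * x"
proof (cases "x \<ge> 1")
  case True
  then have l: "ln x \<ge> 0" by simp
  then have "(\<bar>ln x\<bar> + 4) * (1 + \<bar>ln x\<bar>) \<le> (4 * (1 + ln x)) * (1 + ln x)"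
    by (intro mult_mono) auto
  also have "\<dots> = 4 * (1 + ln x) ^ 2" by (simp add: power2_eq_square)
  also have "\<dots> \<le> 4 * (4 * x)" using ln_square_le(1)[OF True] by simp
  finally show ?thesis using True by simp
next
  case False
  have "ln (1/2) \<le> ln x" using assms by (subst ln_le_cancel_iff) auto
  then have "\<bar>ln x\<bar> \<le> ln 2" using False assms by (simp add: ln_div)
  also have "ln 2 \<le> (1::real)" using ln_le_minus_one[of 2] by simp
  finally have "(\<bar>ln x\<bar> + 4) * (1 + \<bar>ln x\<bar>) \<le> 5 * 2" by (intro mult_mono) auto
  also have "\<dots> \<le> 20 * x" using assms by simp
  finally show ?thesis .
qed

text \<open>
  With \<open>x = n * \<bar>v\<bar>\<close> and \<open>\<bar>ln n + Ln v\<bar> \<le> \<bar>ln x\<bar> + pi\<close>, replacing \<open>Ln v\<close> by \<open>- ln n\<close>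
  costs a factor that grows only logarithmically in \<open>x\<close>.
\<close>
lemma recip_gf_half_freeze:
  fixes v :: complex and n :: nat
  assumes v: "v \<noteq> 0" "norm v \<le> exp (- 6)" and n: "1 / (2 * real n) \<le> norm v" "ln (real n) \<ge> 4" "n > 0"
  shows "norm (1 / recip_gf (1/2) v - of_real (2 / (2 - ln (real n))) * inverse v) \<le>
    120 * (real n / ln (real n) ^ 2)"
proof -
  define t where "t = - ln (norm v)"
  define \<mu> where "\<mu> = ln (real n)"
  define x where "x = real n * norm v"
  define a where "a = \<bar>ln x\<bar>"
  have t: "t \<ge> 6"
  proof -
    have "ln (norm v) \<le> ln (exp (- 6))" using v by (subst ln_le_cancel_iff) auto
    then show ?thesis by (simp add: t_def)
  qed
  have x: "x \<ge> 1/2" using n by (simp add: x_def field_simps)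
  have lnx: "ln x = \<mu> - t" using v n by (simp add: x_def t_def \<mu>_def ln_mult)
  have \<mu>: "\<mu> \<ge> 4" using n by (simp add: \<mu>_def)
  have Re: "Re (Ln v) = - t" using v by (simp add: t_def Re_Ln)
  have Im: "\<bar>Im (Ln v)\<bar> \<le> 4"
    using mpi_less_Im_Ln[OF v(1)] Im_Ln_le_pi[OF v(1)] pi_less_4 by linarith
  \<comment> \<open>The real part is \<open>2 - t\<close>, and \<open>t - 2 \<ge> 2 t / 3\<close>
    exactly when \<open>t \<ge> 6\<close>; hence the radius \<open>exp (- 6)\<close>.\<close>
  have A: "norm (2 + Ln v) \<ge> 2 / 3 * t"
    using abs_Re_le_cmod[of "2 + Ln v"] Re t by simp
  have A0: "2 + Ln v \<noteq> 0" using A t by auto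
  have B: "norm (of_real \<mu> + Ln v) \<le> a + 4"
  proof -
    have "norm (of_real \<mu> + Ln v) \<le> \<bar>Re (of_real \<mu> + Ln v)\<bar> + \<bar>Im (of_real \<mu> + Ln v)\<bar>"
      by (rule cmod_le)
    then show ?thesis using Re Im lnx by (simp add: a_def)
  qed
  have D0: "complex_of_real (2 - \<mu>) \<noteq> 0" using \<mu> by (simp del: of_real_diff)
  \<comment> \<open>Trades the factor \<open>1 / t\<close>, which depends on \<open>v\<close>, for
    \<open>1 / \<mu>\<close> at the cost of a factor \<open>1 + a\<close>.\<close>
  have "\<mu> \<le> a + t" using lnx by (simp add: a_def)
  also have "\<dots> \<le> (1 + a) * t"
  proof -
    have "a * 1 \<le> a * t" using t by (intro mult_left_mono) (auto simp: a_def)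
    then show ?thesis by (simp add: algebra_simps)
  qed
  finally have \<mu>t: "1 / t \<le> (1 + a) / \<mu>" using \<mu> t by (simp add: field_simps)
  have "1 / recip_gf (1/2) v - of_real (2 / (2 - \<mu>)) * inverse v =
      - (2 * (of_real \<mu> + Ln v) / (v * ((2 + Ln v) * of_real (2 - \<mu>))))"
  proof -
    have r: "1 / recip_gf (1/2) v = 2 / (v * (2 + Ln v))"
      using v A0 by (simp add: recip_gf_def field_simps)
    show ?thesis using v A0 D0
      unfolding r of_real_divide by (simp add: divide_simps, (simp add: algebra_simps)?)
  qed
  then have "norm (1 / recip_gf (1/2) v - of_real (2 / (2 - \<mu>)) * inverse v) =
      2 * norm (of_real \<mu> + Ln v) / (norm v * (norm (2 + Ln v) * \<bar>2 - \<mu>\<bar>))"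
    by (simp only: norm_minus_cancel norm_divide norm_mult norm_of_real) simp
  also have "\<dots> \<le> 2 * (a + 4) / (norm v * (2 / 3 * t * (\<mu> / 2)))"
    using A B t \<mu> v by (intro frac_le mult_mono mult_pos_pos mult_nonneg_nonneg) (auto simp: a_def)
  also have "\<dots> = 6 * (a + 4) * (1 / t) / (norm v * \<mu>)"
    using t by (simp add: field_simps)
  also have "\<dots> \<le> 6 * (a + 4) * ((1 + a) / \<mu>) / (norm v * \<mu>)"
    using \<mu>t \<mu> by (intro divide_right_mono mult_left_mono) (auto simp: a_def)
  also have "\<dots> = 6 * ((a + 4) * (1 + a)) / (norm v * \<mu> ^ 2)"
    by (simp add: power2_eq_square mult.assoc[symmetric] distrib_left)
  \<comment> \<open>Since \<open>x = n * |v|\<close>, the \<open>|v|\<close> in the denominator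
    cancels and a multiple of \<open>n / \<mu>^2\<close> is left.\<close>
  also have "\<dots> \<le> 6 * (20 * x) / (norm v * \<mu> ^ 2)"
    using abs_ln_poly_le[OF x] \<mu> by (intro divide_right_mono mult_left_mono) (auto simp: a_def)
  also have "\<dots> = 120 * (real n / \<mu> ^ 2)" using v by (simp add: x_def)
  finally show ?thesis by (simp add: \<mu>_def)
qed

text \<open>The function \<open>1 / (v (1 + Ln v / 2))\<close> is compared with
  \<open>l v = d / v\<close>, where \<open>Ln v\<close> is frozen at \<open>- ln n\<close>. Transfer
  is applied for each large \<open>n\<close> with \<open>\<beta> = 0\<close> and a bound of order
  \<open>n / ln^2 n\<close>, so the coefficient error is \<open>O(1 / ln^2 n)\<close>.\<close>

lemma asymp_half:
  "(\<lambda>n. expected_paths (1/2) n - 1 / (1 - 1/2) * growth_rate (1/2) ^ n - (- (2 / ln (real n))))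
     \<in> O(\<lambda>n. 1 / ln (real n) ^ 2)"
proof -
  have p: "0 < (1/2::real)" "(1/2::real) < 1" by auto
  define c :: real where "c = gf_root (1/2)"
  have c: "0 < c" "c < 1" using gf_root_bounds[OF p] by (auto simp: c_def)
  define k where "k = complex_of_real (1 / ((1 - 1/2) * c))"
  obtain g where g_hol: "g holomorphic_on - \<real>\<^sub>\<le>\<^sub>0" and
    g_eq: "\<And>v. v \<in> - \<real>\<^sub>\<le>\<^sub>0 \<Longrightarrow> v \<noteq> of_real (gf_root (1/2)) \<Longrightarrow>
       g v = 1 / recip_gf (1/2) v - 1 / (of_real (1 - 1/2) * (v - of_real (gf_root (1/2))))"
    using gf_without_pole[OF p] by blast
  \<comment> \<open>A crude bound of order \<open>1 / |v|\<close>, with nothing subtracted; through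
    \<open>remainder_bound\<close> it gives \<open>M\<^sub>1\<close>, which serves where
    \<open>|v|\<close> exceeds \<open>\<epsilon>\<close>.\<close>
  have "norm (1 / recip_gf (1/2) v - 0) \<le> 1 / 2 * norm v powr (- 1)"
    if v: "v \<noteq> 0" "norm v \<le> exp (- 6)" for v
  proof -
    have "ln (norm v) \<le> ln (exp (- 6))" using v by (subst ln_le_cancel_iff) auto
    then have "2 \<le> norm (1 + Ln v / 2)"
      using abs_Re_le_cmod[of "1 + Ln v / 2"] Re_Ln[OF v(1)] by simp
    then have "norm v * 2 \<le> norm (recip_gf (1/2) v)"
      using v by (simp add: recip_gf_def norm_mult mult_left_mono)
    then have "1 / norm (recip_gf (1/2) v) \<le> 1 / (norm v * 2)"
      using v by (intro divide_left_mono mult_pos_pos) auto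
    then show ?thesis using v by (simp add: norm_divide powr_minus field_simps)
  qed
  then obtain M\<^sub>1 where M\<^sub>1: "M\<^sub>1 \<ge> 0" "\<And>v. - norm v / 3 \<le> Re v \<Longrightarrow> v \<noteq> 0 \<Longrightarrow> norm v \<le> 3 \<Longrightarrow>
      norm (g v - k - 0) \<le> M\<^sub>1 * norm v powr (- 1)"
    using remainder_bound[OF p g_hol g_eq, of "\<lambda>_. 0" 1 "exp (- 6)" "1/2"] unfolding k_def c_def by force
  define \<epsilon> where "\<epsilon> = min (exp (- 6)) (c / 2)"
  have \<epsilon>: "\<epsilon> > 0" "\<epsilon> \<le> exp (- 6)" "\<epsilon> \<le> c / 2" using c by (auto simp: \<epsilon>_def)
  have near: "norm (g v - k - 1 / recip_gf (1/2) v) \<le> 4 / c + norm k"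
    if v: "- norm v / 3 \<le> Re v" "v \<noteq> 0" "norm v \<le> \<epsilon>" for v
  proof -
    define w where "w = v - of_real c"
    have w: "norm w \<ge> c / 2"
      using norm_triangle_ineq2[of "of_real c" v] v \<epsilon> c by (simp add: w_def norm_minus_commute)
    then have "w \<noteq> 0" using c by auto
    then have "g v = 1 / recip_gf (1/2) v - 1 / (of_real (1 - 1/2) * w)"
      unfolding w_def c_def using sector_subset_slit[OF v(1,2)] by (intro g_eq) auto
    then have "g v - k - 1 / recip_gf (1/2) v = - (2 / w + k)" by (simp add: field_simps)
    then have "norm (g v - k - 1 / recip_gf (1/2) v) \<le> norm (2 / w) + norm k"
      by (metis norm_minus_cancel norm_triangle_ineq)
    also have "norm (2 / w) \<le> 2 / (c / 2)"
      unfolding norm_divide using w c by (intro frac_le) auto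
    finally show ?thesis by simp
  qed
  \<comment> \<open>The three summands cover the freezing error, the bounded difference between
    \<open>g - k\<close> and \<open>1 / recip_gf\<close> near 0, and the range
    \<open>|v| > \<epsilon>\<close>.\<close>
  define C where "C = 120 + 4 * (4 / c + norm k) + 4 * ((M\<^sub>1 + 1) / \<epsilon>)"
  define K where "K = (384 * 11 * exp 2 * 2 powr \<bar>0::real\<bar>) * C"
  have main: "norm (expected_paths (1/2) n - 1 / (1 - 1/2) * growth_rate (1/2) ^ n - 2 / (2 - ln (real n))) \<le>
      K * (1 / ln (real n) ^ 2)" if n: "n \<ge> 4" "ln (real n) \<ge> 4" for n
  proof -
    define \<mu> where "\<mu> = ln (real n)"
    define d where "d = 2 / (2 - \<mu>)"
    have \<mu>: "\<mu> \<ge> 4" using n by (simp add: \<mu>_def)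
    \<comment> \<open>Converts bounded quantities into multiples of \<open>n / \<mu>^2\<close>, the
      order aimed at.\<close>
    have nl: "1 \<le> 4 * (real n / \<mu> ^ 2)"
      using ln_square_le(2)[of "real n"] n \<mu> by (simp add: \<mu>_def field_simps)
    have d: "\<bar>d\<bar> \<le> 1" using \<mu> by (simp add: d_def abs_divide field_simps)
    have M0: "C * (real n / \<mu> ^ 2) \<ge> 0" using M\<^sub>1 \<epsilon> c by (auto simp: C_def intro!: mult_nonneg_nonneg add_nonneg_nonneg)
    define l where "l v = of_real d * inverse v" for v :: complex
    have l_hol: "l holomorphic_on - \<real>\<^sub>\<le>\<^sub>0"
      unfolding l_def by (intro holomorphic_intros) auto
    have l_fps: "(\<lambda>z. l (1 - z)) has_fps_expansion (fps_const (of_real d) * inverse (1 - fps_X))"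
      unfolding l_def by (intro has_fps_expansion_mult has_fps_expansion_const has_fps_expansion_inverse
        has_fps_expansion_diff has_fps_expansion_1 has_fps_expansion_fps_X) simp
    have "norm (complex_of_real (expected_paths (1/2) n - 1 / (1 - 1/2) * growth_rate (1/2) ^ n) -
        fps_nth (fps_const (of_real d) * inverse (1 - fps_X)) (n - 1)) \<le>
        (384 * 11 * exp 2 * 2 powr \<bar>0::real\<bar>) * (C * (real n / \<mu> ^ 2)) * real n powr (0 - 1)"
    proof (rule expected_paths_transfer[OF p g_hol g_eq l_hol l_fps M0 _ n(1)])
      fix v assume v: "- norm v / 3 \<le> Re v" "1 / (2 * real n) \<le> norm v" "norm v \<le> 3"
      have "0 < 1 / (2 * real n)" using n by simp
      then have v0: "v \<noteq> 0" using v by auto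
      have X: "norm (g v - k - l v) \<le> C * (real n / \<mu> ^ 2)"
      proof (cases "norm v \<le> \<epsilon>")
        case True
        have "norm (1 / recip_gf (1/2) v - l v) \<le> 120 * (real n / \<mu> ^ 2)"
          unfolding l_def d_def \<mu>_def using v v0 True \<epsilon> n by (intro recip_gf_half_freeze) auto
        moreover have "norm (g v - k - l v) \<le> norm (g v - k - 1 / recip_gf (1/2) v) + norm (1 / recip_gf (1/2) v - l v)"
          using norm_triangle_ineq[of "g v - k - 1 / recip_gf (1/2) v" "1 / recip_gf (1/2) v - l v"]
          by (simp only: diff_add_cancel diff_add_eq add_diff_eq)
        moreover have "(4 / c + norm k) * 1 \<le> (4 / c + norm k) * (4 * (real n / \<mu> ^ 2))"
          using nl c by (intro mult_left_mono) auto
        moreover have "C * q = 120 * q + (4 / c + norm k) * (4 * q) + 4 * ((M\<^sub>1 + 1) / \<epsilon>) * q" for q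
          unfolding C_def distrib_right distrib_left by (simp only: mult_ac)
        moreover have "0 \<le> 4 * ((M\<^sub>1 + 1) / \<epsilon>) * (real n / \<mu> ^ 2)"
          using M\<^sub>1 \<epsilon> by (intro mult_nonneg_nonneg) auto
        ultimately show ?thesis using near[OF v(1) v0 True] by (smt (verit) mult_1_right)
      next
        case False
        have "norm (g v - k - l v) \<le> norm (g v - k - 0) + norm (l v)"
          by (simp add: norm_triangle_ineq4)
        also have "norm (l v) \<le> 1 * norm v powr (- 1)"
          using d v0 by (simp add: l_def norm_mult norm_inverse powr_minus mult_left_le_one_le del: of_real_divide)
        also have "norm (g v - k - 0) \<le> M\<^sub>1 * norm v powr (- 1)" by (rule M\<^sub>1(2)[OF v(1) v0 v(3)])
        also have "M\<^sub>1 * norm v powr (- 1) + 1 * norm v powr (- 1) = (M\<^sub>1 + 1) / norm v"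
          using v0 by (simp add: powr_minus divide_inverse distrib_right)
        also have "\<dots> \<le> (M\<^sub>1 + 1) / \<epsilon> * 1"
          using False \<epsilon> M\<^sub>1 v0 by (simp, intro divide_left_mono mult_pos_pos) auto
        also have "\<dots> \<le> (M\<^sub>1 + 1) / \<epsilon> * (4 * (real n / \<mu> ^ 2))"
          using nl M\<^sub>1 \<epsilon> by (intro mult_left_mono) auto
        also have "\<dots> = 4 * ((M\<^sub>1 + 1) / \<epsilon>) * (real n / \<mu> ^ 2)" by simp
        also have "\<dots> \<le> C * (real n / \<mu> ^ 2)"
          using c by (intro mult_right_mono) (auto simp: C_def)
        finally show ?thesis by simp
      qed
      then show "norm (g v - of_real (1 / ((1 - 1/2) * gf_root (1/2))) - l v) \<le> C * (real n / \<mu> ^ 2) * norm v powr (- 0)"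
        using v0 by (simp add: k_def c_def)
    next
      show "- 1 \<le> (0::real)" by simp
    qed
    also have "(384 * 11 * exp 2 * 2 powr \<bar>0::real\<bar>) * (C * (real n / \<mu> ^ 2)) * real n powr (0 - 1) = K * (1 / \<mu> ^ 2)"
      using n by (simp add: K_def powr_minus)
    also have "fps_nth (fps_const (of_real d) * inverse (1 - fps_X)) (n - 1) = complex_of_real d"
      using inverse_const_minus_fps_X_nth[of "1::complex" "n - 1"] by simp
    finally show ?thesis unfolding d_def \<mu>_def by (simp only: of_real_diff[symmetric] norm_of_real real_norm_def)
  qed
  show ?thesis
  proof (rule bigoI)
    have "eventually (\<lambda>n. ln (real n) \<ge> 4) sequentially" by real_asymp
    with eventually_ge_at_top[of 4]
    show "eventually (\<lambda>n. norm (expected_paths (1/2) n - 1 / (1 - 1/2) * growth_rate (1/2) ^ n - (- (2 / ln (real n)))) \<le>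
      (K + 8) * norm (1 / ln (real n) ^ 2)) sequentially"
    proof eventually_elim
      case (elim n)
      define \<mu> where "\<mu> = ln (real n)"
      have \<mu>: "\<mu> \<ge> 4" using elim by (simp add: \<mu>_def)
      \<comment> \<open>Replacing the denominator \<open>2 - \<mu>\<close> by \<open>- \<mu>\<close>
        changes the main term by \<open>O(1 / \<mu>^2)\<close>, within the error.\<close>
      have "2 / (2 - \<mu>) + 2 / \<mu> = - (4 / (\<mu> * (\<mu> - 2)))" using \<mu> by (simp add: divide_simps)
      moreover have "4 / (\<mu> * (\<mu> - 2)) \<le> 4 / (\<mu> * (\<mu> / 2))"
        using \<mu> by (intro divide_left_mono mult_left_mono mult_pos_pos) auto
      moreover have "4 / (\<mu> * (\<mu> / 2)) = 8 * (1 / \<mu> ^ 2)" by (simp add: power2_eq_square)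
      moreover have "0 \<le> 4 / (\<mu> * (\<mu> - 2))" using \<mu> by simp
      ultimately have "\<bar>2 / (2 - \<mu>) + 2 / \<mu>\<bar> \<le> 8 * (1 / \<mu> ^ 2)" by linarith
      moreover have "\<bar>x - (- b)\<bar> \<le> \<bar>x - a\<bar> + \<bar>a + b\<bar>" for x a b :: real by linarith
      ultimately show ?case
        using main[OF elim] unfolding \<mu>_def[symmetric] real_norm_def distrib_right abs_divide abs_one abs_power2
        by (meson add_mono order_trans)
    qed
  qed
qed

theorem theorem4:
  fixes p :: real
  assumes "0 < p" and "p < 1"
  shows "(\<forall>n\<ge>1. expected_paths p n =
      (if p \<noteq> 1/2
       then \<Sum>j=0..n-1. (-1) ^ (n + j - 1) * (((2 * p - 1) * real j - 1) gchoose (n - 1)) *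
              (\<Sum>k=0..n-1. real (k choose j) * (p / (2 * p - 1)) ^ k)
       else \<Sum>k=0..n-1. (-1) ^ k / 2 ^ k *
              complete_bell k (\<lambda>j. - (fact (j - 1) * gen_harm j (n - 1))))) \<and>
    (\<exists>R :: nat \<Rightarrow> real.
      (\<forall>n\<ge>1. expected_paths p n = 1 / (1 - p) * growth_rate p ^ n + R n) \<and>
      (p < 1/2 \<longrightarrow>
        (\<lambda>n. R n - (- ((1 - 2 * p) / (p * Gamma (2 * p))) * real n powr (2 * p - 1)))
          \<in> O(\<lambda>n. real n powr (2 * (2 * p - 1)))) \<and>
      (p = 1/2 \<longrightarrow>
        (\<lambda>n. R n - (- (2 / ln (real n)))) \<in> O(\<lambda>n. 1 / ln (real n) ^ 2)) \<and>
      (1/2 < p \<longrightarrow>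
        (\<lambda>n. R n - (- ((2 * p - 1) / (1 - p)))) \<in> O(\<lambda>n. real n powr (1 - 2 * p))))"
proof (intro conjI allI impI exI[of _ "\<lambda>n. expected_paths p n - 1 / (1 - p) * growth_rate p ^ n"])
  \<comment> \<open>\<open>R\<close> is the difference itself, so the decomposition holds by
    definition; the exact formulas and the three estimates remain.\<close>
  fix n :: nat assume "n \<ge> 1"
  then show "expected_paths p n =
      (if p \<noteq> 1/2
       then \<Sum>j=0..n-1. (-1) ^ (n + j - 1) * (((2 * p - 1) * real j - 1) gchoose (n - 1)) *
              (\<Sum>k=0..n-1. real (k choose j) * (p / (2 * p - 1)) ^ k)
       else \<Sum>k=0..n-1. (-1) ^ k / 2 ^ k *
              complete_bell k (\<lambda>j. - (fact (j - 1) * gen_harm j (n - 1))))"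
  proof (cases "p = 1/2")
    case True
    show ?thesis unfolding True by (simp add: expected_paths_exact_half)
  next
    case False
    then show ?thesis using assms \<open>n \<ge> 1\<close> by (simp add: expected_paths_exact)
  qed
next
  assume "p = 1/2"
  then show "(\<lambda>n. expected_paths p n - 1 / (1 - p) * growth_rate p ^ n - (- (2 / ln (real n)))) \<in> O(\<lambda>n. 1 / ln (real n) ^ 2)"
    using asymp_half by (simp only:)
qed (use assms asymp_less_half asymp_greater_half in auto)

end
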